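(* Let $p=4$, let every edge of the triangle on vertices $\{1,2,3\}$ have negative signature ($\varepsilon_{12}=\varepsilon_{13}=\varepsilon_{23}=-1$), and take $$(a_{12},a_{13},a_{23})=(8739145,\,3903820,\,8576922),$$ $$b=(-3969860,\,-8425563,\,20915687727748),\qquad\nu=(12411,\,482,\,20915691304489).$$ This signed weighted graph has exactly nine eigenlines and nine distinct spectral values. Consequently $B_3^{\mathrm{opt}}\geq9$.
   Context: For data $d=(a,\varepsilon,b,\nu)$ on $n$ vertices ($a_{ij}=a_{ji}\ge0$, $\varepsilon_{ij}=\varepsilon_{ji}\in\{-1,1\}$ for $i\neq j$, $b_i\in\mathbb R$, $\nu_i>0$) and $p>1$, with $\Phi_p(t)=|t|^{p-2}t$, $\Phi_p(0)=0$, the eigenproblem is $$\sum_{j\neq i}a_{ij}\Phi_p(x_i-\varepsilon_{ij}x_j)+b_i\Phi_p(x_i)=\lambda\nu_i\Phi_p(x_i)\quad(1\le i\le n),\qquad x\in\mathbb R^n\setminus\{0\},\ \lambda\in\mathbb R.$$ The spectral values are the $\lambda$ that occur, forming $\sigma_p(d)$; an eigenline is the class $[x]\in\mathbb RP^{n-1}$ of a solution. $B_n^{\mathrm{opt}}$ is the maximum of $\#\sigma_p(d)$ over all real $p>1$ and all such data $d$ on $n$ vertices. *)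

theory Defs
  imports Complex_Main "HOL-Library.Extended_Nat"
begin

text \<open>
  Vertices are the numbers \<open>1, \<dots>, n\<close>. Functions on vertices are total, but only the values of
  the data at indices in \<open>{1..n}\<close> (and, for pairs, off the diagonal) are ever used.
\<close>

record graph_data =
  edge_weight :: "nat \<Rightarrow> nat \<Rightarrow> real"
  signature :: "nat \<Rightarrow> nat \<Rightarrow> real"
  potential :: "nat \<Rightarrow> real"
  vertex_weight :: "nat \<Rightarrow> real"

definition is_graph_data :: "nat \<Rightarrow> graph_data \<Rightarrow> bool" where
  "is_graph_data n d \<longleftrightarrow>
     (\<forall>i\<in>{1..n}. \<forall>j\<in>{1..n}. i \<noteq> j \<longrightarrow>
        edge_weight d i j = edge_weight d j i \<and> 0 \<le> edge_weight d i j \<and>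
        signature d i j = signature d j i \<and> signature d i j \<in> {-1, 1}) \<and>
     (\<forall>i\<in>{1..n}. 0 < vertex_weight d i)"

text \<open>The value at \<open>0\<close> is \<open>0\<close> for every \<open>p\<close>, because \<open>0 powr _ = 0\<close>.\<close>

definition Phi :: "real \<Rightarrow> real \<Rightarrow> real" where
  "Phi p t = \<bar>t\<bar> powr (p - 2) * t"

text \<open>
  Nonzero vectors of \<open>\<real>\<^sup>n\<close>. A vector is represented by its extension by zero to all indices, so that
  equality of functions is equality of vectors.
\<close>

definition nonzero_vecs :: "nat \<Rightarrow> (nat \<Rightarrow> real) set" where
  "nonzero_vecs n = {x. (\<forall>i. i \<notin> {1..n} \<longrightarrow> x i = 0) \<and> (\<exists>i\<in>{1..n}. x i \<noteq> 0)}"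

definition proportional :: "nat \<Rightarrow> ((nat \<Rightarrow> real) \<times> (nat \<Rightarrow> real)) set" where
  "proportional n = {(x, y). x \<in> nonzero_vecs n \<and> y \<in> nonzero_vecs n \<and>
     (\<exists>c. c \<noteq> 0 \<and> y = (\<lambda>i. c * x i))}"

definition real_proj_space :: "nat \<Rightarrow> (nat \<Rightarrow> real) set set" where
  "real_proj_space n = nonzero_vecs (n + 1) // proportional (n + 1)"

definition eigenpair :: "nat \<Rightarrow> real \<Rightarrow> graph_data \<Rightarrow> real \<Rightarrow> (nat \<Rightarrow> real) \<Rightarrow> bool" where
  "eigenpair n p d lam x \<longleftrightarrow> x \<in> nonzero_vecs n \<and>
     (\<forall>i\<in>{1..n}.
        (\<Sum>j\<in>{1..n} - {i}. edge_weight d i j * Phi p (x i - signature d i j * x j))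
          + potential d i * Phi p (x i)
        = lam * vertex_weight d i * Phi p (x i))"

definition spectral_values :: "nat \<Rightarrow> real \<Rightarrow> graph_data \<Rightarrow> real set" where
  "spectral_values n p d = {lam. \<exists>x. eigenpair n p d lam x}"

definition eigenlines :: "nat \<Rightarrow> real \<Rightarrow> graph_data \<Rightarrow> (nat \<Rightarrow> real) set set" where
  "eigenlines n p d =
     {L \<in> real_proj_space (n - 1). \<exists>x lam. eigenpair n p d lam x \<and> L = proportional n `` {x}}"

definition ecard :: "'a set \<Rightarrow> enat" where
  "ecard A = (if finite A then enat (card A) else \<infinity>)"

text \<open>
  The maximum is taken as a supremum in \<^typ>\<open>enat\<close>: a finite supremum of a nonempty set there is
  attained, and no existence or finiteness of the maximum has to be presupposed.
\<close>

definition B_opt :: "nat \<Rightarrow> enat" where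
  "B_opt n = (SUP (p, d) \<in> {(p, d). 1 < p \<and> is_graph_data n d}. ecard (spectral_values n p d))"

definition triangle_graph :: graph_data where
  "triangle_graph =
     \<lparr> edge_weight = (\<lambda>i j. if {i, j} = {1, 2} then 8739145
                           else if {i, j} = {1, 3} then 3903820
                           else if {i, j} = {2, 3} then 8576922 else 0),
       signature = (\<lambda>i j. -1),
       potential = (\<lambda>i. if i = 1 then -3969860
                        else if i = 2 then -8425563
                        else if i = 3 then 20915687727748 else 0),
       vertex_weight = (\<lambda>i. if i = 1 then 12411
                            else if i = 2 then 482
                            else if i = 3 then 20915691304489 else 1) \<rparr>"

end

theory Submission
  imports Defs "HOL-Analysis.Brouwer_Fixpoint"
begin

text \<open>
  For \<open>p = 4\<close> the equations are cubic. Up to sign an eigenvector has all entries of one sign, and then it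
  is unique by a Perron argument, or two entries of opposite (or zero) sign. In the latter case order
  the vertices so that the first two entries are \<open>1\<close> and \<open>t \<in> [-1, 0]\<close>, with third entry \<open>z\<close>. Eliminating
  the eigenvalue from the first two equations gives a function decreasing in \<open>z\<close>, whose zero set is
  a graph over \<open>t\<close>; eliminating it from the first and third equation gives a second curve. The graph is
  covered by thin parallelograms, on each of which affine arithmetic either excludes the second curve or
  shows that the two curves cross exactly once: existence by the Poincare-Miranda theorem, uniqueness because a
  common chord of both curves would contradict the bounds on their slopes. Enclosures of the eigenvalues
  in the parallelograms are disjoint.
\<close>

text \<open>The condition t <= 0 makes the search one-dimensional. In the eliminated equation z
  occurs in two cubes, one of them with a factor t^3. For t <= 0 both terms decrease in z; for t > 0
  they compete. So z needs no a priori bound: signs on the two long sides of a parallelogram confine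
  the curve, and only the compact range of t is subdivided. Three vertex orders suffice. If entries
  1 and 2 do not share a strict sign, the larger in modulus is scaled to 1. If they do and entry 3
  is opposite to both, entry 3 is scaled to 1, and a crude bound on the eigenvalue keeps t above
  -1/2. The cut points between the sixth, seventh and eighth eigenvalue exceed 1 by only about 10^-8
  and 10^-7. Eigenvalues are therefore bounded through the equation of vertex 3, whose weight of
  about 2 * 10^13 divides the error of the enclosure. The positive eigenvector lies outside the
  monotone region. One parallelogram gives its existence and the Perron comparison its
  uniqueness.\<close>

section \<open>Affine arithmetic\<close>

text \<open>The triple \<open>(a, b, e)\<close> encloses \<open>x\<close> by \<open>(a + b s \<plusminus> e) / 2 ^ 48\<close>, where \<open>s \<in> [-1, 1]\<close> is the position in a strip.\<close>

type_synonym affine = "int \<times> int \<times> int"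

fun represents :: "real \<Rightarrow> affine \<Rightarrow> real \<Rightarrow> bool" where
  "represents s (a, b, e) x \<longleftrightarrow> \<bar>2 ^ 48 * x - of_int a - of_int b * s\<bar> \<le> of_int e"

definition aff_const :: "int \<Rightarrow> affine" where
  "aff_const k = (push_bit 48 k, 0, 0)"

fun aff_add :: "affine \<Rightarrow> affine \<Rightarrow> affine" where
  "aff_add (a, b, e) (c, d, f) = (a + c, b + d, e + f)"

fun aff_scale :: "int \<Rightarrow> affine \<Rightarrow> affine" where
  "aff_scale k (a, b, e) = (k * a, k * b, \<bar>k\<bar> * e)"

text \<open>The product of the two linear terms is quadratic in s and joins the error. The summand 3
  pays for three downward roundings: of the centre, of the slope and of the error itself.\<close>

fun aff_mult :: "affine \<Rightarrow> affine \<Rightarrow> affine" where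
  "aff_mult (a, b, e) (c, d, f) =
     (drop_bit 48 (a * c), drop_bit 48 (a * d + b * c),
      drop_bit 48 (\<bar>b * d\<bar> + (\<bar>a\<bar> + \<bar>b\<bar>) * f + (\<bar>c\<bar> + \<bar>d\<bar>) * e + e * f) + 3)"

fun aff_power :: "affine \<Rightarrow> nat \<Rightarrow> affine" where
  "aff_power x 0 = aff_const 1"
| "aff_power x (Suc n) = (if n = 0 then x else aff_mult x (aff_power x n))"

fun aff_upper :: "affine \<Rightarrow> int" where
  "aff_upper (a, b, e) = \<bar>a\<bar> + \<bar>b\<bar> + e"

text \<open>A lower bound for the modulus: a positive value excludes a zero, whatever the sign of
  the quantity.\<close>

fun aff_lower :: "affine \<Rightarrow> int" where
  "aff_lower (a, b, e) = \<bar>a\<bar> - \<bar>b\<bar> - e"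

fun aff_pos :: "affine \<Rightarrow> bool" where
  "aff_pos (a, b, e) \<longleftrightarrow> \<bar>b\<bar> + e < a"

lemma represents_const: "represents s (aff_const k) (of_int k)"
  by (simp add: aff_const_def push_bit_eq_mult)

lemma represents_add:
  "represents s A x \<Longrightarrow> represents s B y \<Longrightarrow> represents s (aff_add A B) (x + y)"
  by (cases A; cases B) (simp add: algebra_simps abs_le_iff)

lemma represents_scale:
  fixes x :: real
  assumes "represents s A x"
  shows "represents s (aff_scale k A) (of_int k * x)"
proof -
  obtain a b e where A: "A = (a, b, e)" by (cases A)
  have "\<bar>2 ^ 48 * (of_int k * x) - of_int (k * a) - of_int (k * b) * s\<bar>
      = \<bar>of_int k\<bar> * \<bar>2 ^ 48 * x - of_int a - of_int b * s\<bar>"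
    by (subst abs_mult[symmetric]) (simp add: algebra_simps)
  also have "\<dots> \<le> \<bar>of_int k\<bar> * of_int e"
    using assms by (intro mult_left_mono) (auto simp: A)
  finally show ?thesis by (simp add: A)
qed

lemma represents_mult:
  fixes x y :: real
  assumes x: "represents s A x" and y: "represents s B y" and s: "\<bar>s\<bar> \<le> 1"
  shows "represents s (aff_mult A B) (x * y)"
proof -
  obtain a b e where A: "A = (a, b, e)" by (cases A)
  obtain c d f where B: "B = (c, d, f)" by (cases B)
  define u v where "u = 2 ^ 48 * x" and "v = 2 ^ 48 * y"
  define p q where "p = of_int a + of_int b * s" and "q = of_int c + of_int d * s"
  define ra rb re rc rd rf :: real where "ra = of_int a" and "rb = of_int b" and "re = of_int e"
    and "rc = of_int c" and "rd = of_int d" and "rf = of_int f"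
  note r_defs = ra_def rb_def re_def rc_def rd_def rf_def
  have u: "\<bar>u - p\<bar> \<le> re" and v: "\<bar>v - q\<bar> \<le> rf"
    using x y by (simp_all add: A B u_def v_def p_def q_def r_defs algebra_simps)
  have bs: "\<bar>k * s\<bar> \<le> \<bar>k\<bar>" for k :: real
    using mult_left_mono[OF s, of "\<bar>k\<bar>"] by (simp add: abs_mult)
  have p: "\<bar>p\<bar> \<le> \<bar>ra\<bar> + \<bar>rb\<bar>" and q: "\<bar>q\<bar> \<le> \<bar>rc\<bar> + \<bar>rd\<bar>"
    using bs[of rb] bs[of rd] unfolding p_def q_def r_defs by linarith+
  have terms: "\<bar>(u - p) * (v - q)\<bar> \<le> re * rf" "\<bar>p * (v - q)\<bar> \<le> (\<bar>ra\<bar> + \<bar>rb\<bar>) * rf"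
    "\<bar>q * (u - p)\<bar> \<le> (\<bar>rc\<bar> + \<bar>rd\<bar>) * re"
    unfolding abs_mult using u v p q by (auto intro!: mult_mono)
  have square: "\<bar>rb * rd * s * s\<bar> \<le> \<bar>rb * rd\<bar>"
    using bs[of "rb * rd * s"] bs[of "rb * rd"] by (simp add: ac_simps)
  have "\<bar>u * v - ra * rc - (ra * rd + rb * rc) * s\<bar>
      = \<bar>(u - p) * (v - q) + p * (v - q) + q * (u - p) + rb * rd * s * s\<bar>"
    by (simp add: p_def q_def r_defs algebra_simps)
  also have "\<dots> \<le> \<bar>(u - p) * (v - q)\<bar> + \<bar>p * (v - q)\<bar> + \<bar>q * (u - p)\<bar> + \<bar>rb * rd * s * s\<bar>"
    by (intro order_trans[OF abs_triangle_ineq] add_mono order_refl)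
  also have "\<dots> \<le> re * rf + (\<bar>ra\<bar> + \<bar>rb\<bar>) * rf + (\<bar>rc\<bar> + \<bar>rd\<bar>) * re + \<bar>rb * rd\<bar>"
    by (intro add_mono terms square)
  finally have uv: "\<bar>u * v - ra * rc - (ra * rd + rb * rc) * s\<bar> \<le> \<dots>" .
  define S :: int where "S = 2 ^ 48"
  define n1 n2 n3 where "n1 = a * c" and "n2 = a * d + b * c"
    and "n3 = \<bar>b * d\<bar> + (\<bar>a\<bar> + \<bar>b\<bar>) * f + (\<bar>c\<bar> + \<bar>d\<bar>) * e + e * f"
  define q1 q2 q3 :: real where "q1 = of_int n1 / of_int S" and "q2 = of_int n2 / of_int S"
    and "q3 = of_int n3 / of_int S"
  have S: "S > 0" by (simp add: S_def)
  have floors: "of_int (n div S) \<le> real_of_int n / of_int S"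
    "real_of_int n / of_int S \<le> of_int (n div S) + 1" for n
    unfolding floor_divide_of_int_eq[symmetric, where 'a = real] by linarith+
  have "\<bar>u * v - of_int n1 - of_int n2 * s\<bar> \<le> of_int n3"
    using uv by (simp add: n1_def n2_def n3_def r_defs abs_mult add_ac)
  then have "\<bar>u * v - of_int n1 - of_int n2 * s\<bar> / of_int S \<le> q3"
    unfolding q3_def using S by (intro divide_right_mono) auto
  moreover have "(u * v - of_int n1 - of_int n2 * s) / of_int S = 2 ^ 48 * (x * y) - q1 - q2 * s"
    by (simp add: u_def v_def q1_def q2_def S_def field_simps)
  ultimately have "\<bar>2 ^ 48 * (x * y) - q1 - q2 * s\<bar> \<le> q3"
    using S by (metis abs_divide abs_of_pos of_int_0_less_iff)
  moreover have "\<bar>(q2 - of_int (n2 div S)) * s\<bar> \<le> 1"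
    using bs[of "q2 - of_int (n2 div S)"] floors[of n2] unfolding q2_def by linarith
  moreover have "2 ^ 48 * (x * y) - of_int (n1 div S) - of_int (n2 div S) * s
      = (2 ^ 48 * (x * y) - q1 - q2 * s) + (q1 - of_int (n1 div S)) + (q2 - of_int (n2 div S)) * s"
    by (simp add: algebra_simps)
  ultimately have "\<bar>2 ^ 48 * (x * y) - of_int (n1 div S) - of_int (n2 div S) * s\<bar>
      \<le> of_int (n3 div S) + 3"
    using floors[of n1] floors[of n3] unfolding q1_def q3_def by linarith
  then show ?thesis
    by (simp add: A B n1_def n2_def n3_def S_def drop_bit_eq_div)
qed

lemma represents_power:
  fixes x :: real
  assumes "represents s A x" "\<bar>s\<bar> \<le> 1"
  shows "represents s (aff_power A n) (x ^ n)"
proof (induction n)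
  case 0
  show ?case using represents_const[of s 1] by simp
next
  case (Suc n)
  then show ?case using assms represents_mult by (cases "n = 0") auto
qed

lemma represents_bounds:
  fixes x :: real
  assumes "represents s A x" "\<bar>s\<bar> \<le> 1"
  shows "2 ^ 48 * \<bar>x\<bar> \<le> aff_upper A" and "aff_lower A \<le> 2 ^ 48 * \<bar>x\<bar>"
    and "aff_pos A \<Longrightarrow> 0 < x"
proof -
  obtain a b e where A: "A = (a, b, e)" by (cases A)
  have b: "\<bar>of_int b * s\<bar> \<le> \<bar>of_int b\<bar>"
    using mult_left_mono[OF assms(2), of "\<bar>of_int b\<bar>"] by (simp add: abs_mult)
  have x: "\<bar>2 ^ 48 * x - of_int a - of_int b * s\<bar> \<le> of_int e"
    using assms(1) by (simp add: A)
  have "2 ^ 48 * \<bar>x\<bar> = \<bar>2 ^ 48 * x\<bar>" by (simp add: abs_mult)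
  with b x show "2 ^ 48 * \<bar>x\<bar> \<le> aff_upper A" "aff_lower A \<le> 2 ^ 48 * \<bar>x\<bar>"
    unfolding A aff_upper.simps aff_lower.simps of_int_add of_int_diff of_int_abs by linarith+
  assume "aff_pos A"
  then have "real_of_int (\<bar>b\<bar> + e) < of_int a" by (simp only: A aff_pos.simps of_int_less_iff)
  then have "0 < 2 ^ 48 * x"
    using b x unfolding of_int_add of_int_abs by linarith
  then show "0 < x" by simp
qed

section \<open>Polynomial expressions and strips\<close>

text \<open>Expressions are syntax so that one term yields its real value, its enclosure and its
  derivatives. \<open>Scale\<close> is kept apart from \<open>Mul\<close> because an integer factor
  acts on affine triples without rounding.\<close>

datatype expr = T | Z | Num int | Add expr expr | Mul expr expr | Scale int expr | Pow expr nat

primrec eval :: "expr \<Rightarrow> real \<Rightarrow> real \<Rightarrow> real" where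
  "eval T t z = t"
| "eval Z t z = z"
| "eval (Num k) t z = of_int k"
| "eval (Add d e) t z = eval d t z + eval e t z"
| "eval (Mul d e) t z = eval d t z * eval e t z"
| "eval (Scale k e) t z = of_int k * eval e t z"
| "eval (Pow e n) t z = eval e t z ^ n"

primrec enclose :: "expr \<Rightarrow> affine \<Rightarrow> affine \<Rightarrow> affine" where
  "enclose T A B = A"
| "enclose Z A B = B"
| "enclose (Num k) A B = aff_const k"
| "enclose (Add d e) A B = aff_add (enclose d A B) (enclose e A B)"
| "enclose (Mul d e) A B = aff_mult (enclose d A B) (enclose e A B)"
| "enclose (Scale k e) A B = aff_scale k (enclose e A B)"
| "enclose (Pow e n) A B = aff_power (enclose e A B) n"

primrec partial :: "bool \<Rightarrow> expr \<Rightarrow> expr" where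
  "partial c T = Num (if c then 0 else 1)"
| "partial c Z = Num (if c then 1 else 0)"
| "partial c (Num k) = Num 0"
| "partial c (Add d e) = Add (partial c d) (partial c e)"
| "partial c (Mul d e) = Add (Mul (partial c d) e) (Mul d (partial c e))"
| "partial c (Scale k e) = Scale k (partial c e)"
| "partial c (Pow e n) = Mul (Scale (int n) (Pow e (n - 1))) (partial c e)"

abbreviation "partial_t \<equiv> partial False"
abbreviation "partial_z \<equiv> partial True"

lemma represents_enclose:
  assumes "represents s A t" "represents s B z" "\<bar>s\<bar> \<le> 1"
  shows "represents s (enclose e A B) (eval e t z)"
  by (induction e)
    (use assms in \<open>auto intro: represents_const represents_add represents_mult represents_scale represents_power
      simp del: represents.simps\<close>)

lemma continuous_on_eval [continuous_intros]:
  fixes f g :: "'a::topological_space \<Rightarrow> real"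
  assumes "continuous_on S f" "continuous_on S g"
  shows "continuous_on S (\<lambda>x. eval e (f x) (g x))"
  by (induction e) (auto intro!: continuous_intros assms)

lemma DERIV_eval_segment:
  "((\<lambda>s. eval e (t + s * k) (z + s * l)) has_real_derivative
      k * eval (partial_t e) (t + s * k) (z + s * l) + l * eval (partial_z e) (t + s * k) (z + s * l)) (at s)"
proof (induction e)
  case (Pow e n)
  show ?case
    using DERIV_power[OF Pow, of n] by (simp add: algebra_simps)
qed (auto intro!: derivative_eq_intros simp: algebra_simps)

text \<open>Brouwer's theorem is applied to the displacement by (-f, -g), cut off at the square. At
  a fixed point a nonzero f would force the first coordinate onto the side where f has the opposite
  sign; likewise for g.\<close>

lemma poincare_miranda_square:
  fixes f g :: "real \<times> real \<Rightarrow> real"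
  assumes cont: "continuous_on ({-1..1} \<times> {-1..1}) f" "continuous_on ({-1..1} \<times> {-1..1}) g"
    and f: "\<And>s. \<bar>s\<bar> \<le> 1 \<Longrightarrow> f (-1, s) < 0 \<and> 0 < f (1, s)"
    and g: "\<And>s. \<bar>s\<bar> \<le> 1 \<Longrightarrow> g (s, -1) < 0 \<and> 0 < g (s, 1)"
  shows "\<exists>s d. \<bar>s\<bar> \<le> 1 \<and> \<bar>d\<bar> \<le> 1 \<and> f (s, d) = 0 \<and> g (s, d) = 0"
proof -
  define clamp1 :: "real \<Rightarrow> real" where "clamp1 x = max (-1) (min 1 x)" for x
  define \<phi> where "\<phi> x = (clamp1 (fst x - f x), clamp1 (snd x - g x))" for x
  let ?Q = "{-1..1} \<times> {-1..1} :: (real \<times> real) set"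
  have "continuous_on ?Q \<phi>"
    unfolding \<phi>_def clamp1_def by (intro continuous_intros cont)
  moreover have "\<phi> \<in> ?Q \<rightarrow> ?Q"
    by (auto simp: \<phi>_def clamp1_def)
  ultimately obtain x where x: "x \<in> ?Q" "\<phi> x = x"
    by (rule brouwer[of ?Q \<phi>, rotated 3]) (auto intro!: compact_Times convex_Times)
  obtain s d where sd: "x = (s, d)" by (cases x)
  have "f (s, d) = 0" "g (s, d) = 0"
    using x f[of d] g[of s] unfolding sd \<phi>_def clamp1_def
    by (auto simp: max_def min_def abs_le_iff split: if_splits)
  then show ?thesis using x sd by (auto simp: abs_le_iff)
qed


section \<open>Strips: confinement, exclusion and existence of zeros\<close>

text \<open>
  The strip \<open>(m, h, p, q, r)\<close> is the parallelogram \<open>t = m + h s\<close>, \<open>z = p + q s + r d\<close> with \<open>s, d \<in> [-1, 1]\<close>,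
  in units of \<open>2 ^ -30\<close>.
\<close>

type_synonym strip = "int \<times> int \<times> int \<times> int \<times> int"

fun in_strip :: "strip \<Rightarrow> real \<Rightarrow> real \<Rightarrow> bool" where
  "in_strip (m, h, p, q, r) t z \<longleftrightarrow> (\<exists>s d. \<bar>s\<bar> \<le> 1 \<and> \<bar>d\<bar> \<le> 1 \<and>
     2 ^ 30 * t = of_int m + of_int h * s \<and> 2 ^ 30 * z = of_int p + of_int q * s + of_int r * d)"

definition lift :: "int \<Rightarrow> int" where
  "lift k = push_bit 18 k"

fun on_strip :: "strip \<Rightarrow> expr \<Rightarrow> affine" where
  "on_strip (m, h, p, q, r) e = enclose e (lift m, lift h, 0) (lift p, lift q, lift r)"

lemma of_int_lift: "real_of_int (lift k) = 2 ^ 18 * of_int k"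
  by (simp add: lift_def push_bit_eq_mult)

lemma represents_t:
  "2 ^ 30 * t = of_int m + of_int h * s \<Longrightarrow> represents s (lift m, lift h, 0) t"
  by (simp add: of_int_lift field_simps)

text \<open>The coordinate d is forgotten and its range becomes the error part, while the dependence
  on s stays exact and is shared with t.\<close>

lemma represents_z:
  assumes "2 ^ 30 * z = of_int p + of_int q * s + of_int r * d" "\<bar>d\<bar> \<le> 1" "0 \<le> r"
  shows "represents s (lift p, lift q, lift r) z"
proof -
  have "2 ^ 48 * z - of_int (lift p) - of_int (lift q) * s = 2 ^ 18 * (of_int r * d)"
    using assms(1) by (simp add: of_int_lift field_simps)
  moreover have "\<bar>of_int r * d\<bar> \<le> of_int r"
    using assms(2,3) mult_left_mono[of "\<bar>d\<bar>" 1 "of_int r"] by (simp add: abs_mult)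
  ultimately show ?thesis by (simp add: of_int_lift abs_mult)
qed

lemma on_strip_pos:
  assumes "in_strip (m, h, p, q, r) t z" "0 \<le> r" "aff_pos (on_strip (m, h, p, q, r) e)"
  shows "0 < eval e t z"
proof -
  obtain s d where "\<bar>s\<bar> \<le> 1" "\<bar>d\<bar> \<le> 1" "2 ^ 30 * t = of_int m + of_int h * s"
    "2 ^ 30 * z = of_int p + of_int q * s + of_int r * d"
    using assms(1) by auto
  with assms(2,3) show ?thesis
    using represents_bounds(3)[OF represents_enclose[OF represents_t represents_z]] by simp
qed

text \<open>The strips with last component 0 are the two long sides. The signs there confine the
  zeros of a function decreasing in z, and they also form one pair of boundary conditions for
  Poincare-Miranda.\<close>

fun brackets :: "expr \<Rightarrow> strip \<Rightarrow> bool" where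
  "brackets e (m, h, p, q, r) \<longleftrightarrow> 0 < h \<and> 0 < r \<and>
     aff_pos (on_strip (m, h, p - r, q, 0) e) \<and> aff_pos (on_strip (m, h, p + r, q, 0) (Scale (-1) e))"

lemma brackets_below:
  assumes "brackets e (m, h, p, q, r)" "\<bar>s\<bar> \<le> 1" "2 ^ 30 * t = of_int m + of_int h * s"
    "2 ^ 30 * z = of_int p + of_int q * s - of_int r"
  shows "0 < eval e t z"
  using assms by (intro on_strip_pos[of m h "p - r" q 0]) (auto simp: algebra_simps)

lemma brackets_above:
  assumes "brackets e (m, h, p, q, r)" "\<bar>s\<bar> \<le> 1" "2 ^ 30 * t = of_int m + of_int h * s"
    "2 ^ 30 * z = of_int p + of_int q * s + of_int r"
  shows "eval e t z < 0"
  using on_strip_pos[of m h "p + r" q 0 t z "Scale (-1) e"] assms by (auto simp: algebra_simps)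

text \<open>At a point below the lower side, monotonicity makes the value at least the positive one
  on that side. Above the upper side the same holds with signs reversed.\<close>

lemma in_strip_if_antimono:
  assumes "brackets e (m, h, p, q, r)" "antimono (eval e t)" "eval e t z = 0"
    and t: "of_int (m - h) \<le> 2 ^ 30 * t" "2 ^ 30 * t \<le> of_int (m + h)"
  shows "in_strip (m, h, p, q, r) t z"
proof -
  define s where "s = (2 ^ 30 * t - of_int m) / of_int h"
  define c where "c = of_int p + of_int q * s"
  define d where "d = (2 ^ 30 * z - c) / of_int r"
  have pos: "0 < real_of_int h" "0 < real_of_int r" using assms(1) by simp_all
  have s: "\<bar>s\<bar> \<le> 1" "2 ^ 30 * t = of_int m + of_int h * s"
    using t pos by (simp_all add: s_def abs_le_iff field_simps)
  have "\<not> z \<le> (c - of_int r) / 2 ^ 30"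
    using brackets_below[OF assms(1) s, of "(c - of_int r) / 2 ^ 30"] assms(3)
      antimonoD[OF assms(2), of z "(c - of_int r) / 2 ^ 30"] by (auto simp: c_def)
  moreover have "\<not> (c + of_int r) / 2 ^ 30 \<le> z"
    using brackets_above[OF assms(1) s, of "(c + of_int r) / 2 ^ 30"] assms(3)
      antimonoD[OF assms(2), of "(c + of_int r) / 2 ^ 30" z] by (auto simp: c_def)
  ultimately have "\<bar>d\<bar> \<le> 1"
    using pos by (simp add: d_def abs_le_iff field_simps)
  moreover have "2 ^ 30 * z = of_int p + of_int q * s + of_int r * d"
    using pos by (simp add: d_def c_def)
  ultimately show ?thesis using s by auto
qed

fun excludes :: "expr \<Rightarrow> strip \<Rightarrow> bool" where
  "excludes g S \<longleftrightarrow> (let A = on_strip S g in aff_pos A \<or> aff_pos (aff_scale (-1) A))"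

lemma excludes_nonzero:
  assumes "excludes g (m, h, p, q, r)" "in_strip (m, h, p, q, r) t z" "0 \<le> r"
  shows "eval g t z \<noteq> 0"
proof -
  have "on_strip S (Scale (-1) g) = aff_scale (-1) (on_strip S g)" for S
    by (cases S) simp
  then show ?thesis
    using assms on_strip_pos[of m h p q r t z g] on_strip_pos[of m h p q r t z "Scale (-1) g"]
    by (auto simp: Let_def)
qed

text \<open>The two short sides, s = -1 and s = 1, are encoded as strips with both s-coefficients 0.
  The opposite sign change is tested by passing \<open>Scale (-1) g\<close>.\<close>

fun crosses :: "expr \<Rightarrow> strip \<Rightarrow> bool" where
  "crosses g (m, h, p, q, r) \<longleftrightarrow>
     aff_pos (aff_scale (-1) (on_strip (m - h, 0, p - q, 0, r) g)) \<and> aff_pos (on_strip (m + h, 0, p + q, 0, r) g)"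

lemma zero_in_strip:
  assumes "brackets e (m, h, p, q, r)" "crosses g (m, h, p, q, r) \<or> crosses (Scale (-1) g) (m, h, p, q, r)"
  shows "\<exists>t z. in_strip (m, h, p, q, r) t z \<and> eval e t z = 0 \<and> eval g t z = 0"
proof -
  have main: "\<exists>t z. in_strip (m, h, p, q, r) t z \<and> eval e t z = 0 \<and> eval g t z = 0"
    if "crosses g (m, h, p, q, r)" for g
  proof -
    define t z where "t s = (of_int m + of_int h * s) / 2 ^ 30"
      and "z s d = (of_int p + of_int q * s + of_int r * d) / 2 ^ 30" for s d :: real
    have r: "0 \<le> r" using assms(1) by simp
    have "\<exists>s d. \<bar>s\<bar> \<le> 1 \<and> \<bar>d\<bar> \<le> 1 \<and> (\<lambda>(s, d). eval g (t s) (z s d)) (s, d) = 0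
      \<and> (\<lambda>(s, d). - eval e (t s) (z s d)) (s, d) = 0"
    proof (rule poincare_miranda_square, goal_cases)
      case (3 d)
      have "0 < eval (Scale (-1) g) (t (-1)) (z (-1) d)"
        by (rule on_strip_pos[of "m - h" 0 "p - q" 0 r])
          (use that 3 r in \<open>auto simp: t_def z_def intro!: exI[of _ "0::real"] exI[of _ d]\<close>)
      moreover have "0 < eval g (t 1) (z 1 d)"
        by (rule on_strip_pos[of "m + h" 0 "p + q" 0 r])
          (use that 3 r in \<open>auto simp: t_def z_def intro!: exI[of _ "0::real"] exI[of _ d]\<close>)
      ultimately show ?case by simp
    next
      case (4 s)
      have "0 < eval e (t s) (z s (-1))" "eval e (t s) (z s 1) < 0"
        by (rule brackets_below[OF assms(1) 4] brackets_above[OF assms(1) 4]; simp add: t_def z_def)+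
      then show ?case by simp
    qed (auto simp: t_def z_def split_beta intro!: continuous_intros)
    then obtain s d where "\<bar>s\<bar> \<le> 1" "\<bar>d\<bar> \<le> 1" "eval g (t s) (z s d) = 0" "eval e (t s) (z s d) = 0"
      by auto
    moreover from this have "in_strip (m, h, p, q, r) (t s) (z s d)"
      unfolding in_strip.simps by - (rule exI[of _ s], rule exI[of _ d], simp add: t_def z_def)
    ultimately show ?thesis by blast
  qed
  from assms(2) main[of g] main[of "Scale (-1) g"] show ?thesis by auto
qed

section \<open>Uniqueness of a common zero in a strip\<close>

text \<open>
  Two common zeros of \<open>e\<close> and \<open>g\<close> differ by \<open>h\<sigma>\<close> in \<open>t\<close> and by \<open>q\<sigma> + r\<delta>\<close> in \<open>z\<close>. The mean value theorem for
  \<open>e\<close> and for \<open>g\<close> along their chord bounds \<open>\<bar>r\<delta>\<bar>\<close> by \<open>(a / b) \<bar>\<sigma>\<bar>\<close> and \<open>\<bar>\<sigma>\<bar>\<close> by \<open>(d / c) \<bar>r\<delta>\<bar>\<close>.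
\<close>

fun transversal :: "expr \<Rightarrow> expr \<Rightarrow> strip \<Rightarrow> bool" where
  "transversal e g (m, h, p, q, r) \<longleftrightarrow>
     (let along = (\<lambda>f. Add (Scale h (partial_t f)) (Scale q (partial_z f)));
          a = aff_upper (on_strip (m, h, p, q, r) (along e));
          b = aff_lower (on_strip (m, h, p, q, r) (partial_z e));
          c = aff_lower (on_strip (m, h, p, q, r) (along g));
          d = aff_upper (on_strip (m, h, p, q, r) (partial_z g))
      in 0 < b \<and> 0 < c \<and> a * d < b * c)"

text \<open>Up to the unit, the chord is (s' - s) times (h, q) plus (d' - d) times (0, r), so the
  derivative along it splits into these two directions. The intermediate point stays in the strip by
  convexity. It depends on f, which is why bounds over the whole strip are used afterwards.\<close>

lemma in_strip_segment_derivative: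
  assumes "0 < r" "\<bar>s\<bar> \<le> 1" "\<bar>s'\<bar> \<le> 1" "\<bar>d\<bar> \<le> 1" "\<bar>d'\<bar> \<le> 1"
    and t: "2 ^ 30 * t = of_int m + of_int h * s" "2 ^ 30 * t' = of_int m + of_int h * s'"
    and z: "2 ^ 30 * z = of_int p + of_int q * s + of_int r * d"
      "2 ^ 30 * z' = of_int p + of_int q * s' + of_int r * d'"
    and zero: "eval f t z = 0" "eval f t' z' = 0"
  shows "\<exists>u v. in_strip (m, h, p, q, r) u v \<and>
    (s' - s) * eval (Add (Scale h (partial_t f)) (Scale q (partial_z f))) u v
      + of_int r * (d' - d) * eval (partial_z f) u v = 0"
proof -
  define k l where "k = t' - t" and "l = z' - z"
  obtain x :: real where x: "0 < x" "x < 1"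
    "k * eval (partial_t f) (t + x * k) (z + x * l) + l * eval (partial_z f) (t + x * k) (z + x * l) = 0"
    using MVT2[of 0 1 "\<lambda>x. eval f (t + x * k) (z + x * l)", OF _ DERIV_eval_segment] zero
    by (auto simp: k_def l_def)
  have kl: "2 ^ 30 * k = of_int h * (s' - s)" "2 ^ 30 * l = of_int q * (s' - s) + of_int r * (d' - d)"
    using t z by (simp_all add: k_def l_def algebra_simps)
  have convex: "\<bar>y + x * (y' - y)\<bar> \<le> 1" if "\<bar>y\<bar> \<le> 1" "\<bar>y'\<bar> \<le> 1" for y y' :: real
  proof -
    have "y + x * (y' - y) = (1 - x) * y + x * y'" by (simp add: algebra_simps)
    also have "\<bar>\<dots>\<bar> \<le> (1 - x) * \<bar>y\<bar> + x * \<bar>y'\<bar>"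
      using x by (intro order_trans[OF abs_triangle_ineq]) (simp add: abs_mult)
    also have "\<dots> \<le> (1 - x) * 1 + x * 1"
      using x that by (intro add_mono mult_left_mono) auto
    finally show ?thesis by simp
  qed
  have "in_strip (m, h, p, q, r) (t + x * k) (z + x * l)"
    unfolding in_strip.simps
  proof (intro exI conjI)
    show "\<bar>s + x * (s' - s)\<bar> \<le> 1" "\<bar>d + x * (d' - d)\<bar> \<le> 1"
      using convex assms by auto
    show "2 ^ 30 * (t + x * k) = of_int m + of_int h * (s + x * (s' - s))"
      using t(1) arg_cong[OF kl(1), of "(*) x"] by (simp add: algebra_simps)
    show "2 ^ 30 * (z + x * l) = of_int p + of_int q * (s + x * (s' - s)) + of_int r * (d + x * (d' - d))"
      using z(1) arg_cong[OF kl(2), of "(*) x"] by (simp add: algebra_simps)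
  qed
  moreover have "2 ^ 30 * k * eval (partial_t f) (t + x * k) (z + x * l)
      + 2 ^ 30 * l * eval (partial_z f) (t + x * k) (z + x * l) = 0"
    using x(3) by (simp add: mult.assoc flip: distrib_left)
  then have "(s' - s) * eval (Add (Scale h (partial_t f)) (Scale q (partial_z f))) (t + x * k) (z + x * l)
      + of_int r * (d' - d) * eval (partial_z f) (t + x * k) (z + x * l) = 0"
    unfolding kl by (simp add: algebra_simps)
  ultimately show ?thesis by blast
qed

lemma on_strip_bounds:
  assumes "in_strip (m, h, p, q, r) t z" "0 \<le> r"
  shows "2 ^ 48 * \<bar>eval e t z\<bar> \<le> aff_upper (on_strip (m, h, p, q, r) e)"
    and "aff_lower (on_strip (m, h, p, q, r) e) \<le> 2 ^ 48 * \<bar>eval e t z\<bar>"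
proof -
  obtain s d where s: "\<bar>s\<bar> \<le> 1" and t: "2 ^ 30 * t = of_int m + of_int h * s"
    and z: "\<bar>d\<bar> \<le> 1" "2 ^ 30 * z = of_int p + of_int q * s + of_int r * d"
    using assms(1) by auto
  have "represents s (on_strip (m, h, p, q, r) e) (eval e t z)"
    using represents_enclose[OF represents_t[OF t] represents_z[OF z(2,1) assms(2)] s] by simp
  then show "2 ^ 48 * \<bar>eval e t z\<bar> \<le> aff_upper (on_strip (m, h, p, q, r) e)"
    "aff_lower (on_strip (m, h, p, q, r) e) \<le> 2 ^ 48 * \<bar>eval e t z\<bar>"
    using represents_bounds(1,2)[OF _ s] by blast+
qed

lemma transversal_unique:
  assumes "transversal e g (m, h, p, q, r)" "0 < r"
    and "in_strip (m, h, p, q, r) t z" "eval e t z = 0" "eval g t z = 0"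
    and "in_strip (m, h, p, q, r) t' z'" "eval e t' z' = 0" "eval g t' z' = 0"
  shows "t = t' \<and> z = z'"
proof -
  let ?S = "(m, h, p, q, r)"
  define along where "along f = Add (Scale h (partial_t f)) (Scale q (partial_z f))" for f
  define a b c d where "a = real_of_int (aff_upper (on_strip ?S (along e)))"
    and "b = real_of_int (aff_lower (on_strip ?S (partial_z e)))"
    and "c = real_of_int (aff_lower (on_strip ?S (along g)))"
    and "d = real_of_int (aff_upper (on_strip ?S (partial_z g)))"
  have "0 < b" "0 < c" "a * d < b * c"
    using assms(1) by (simp_all add: a_def b_def c_def d_def along_def Let_def flip: of_int_mult)
  obtain s y where sy: "\<bar>s\<bar> \<le> 1" "\<bar>y\<bar> \<le> 1" "2 ^ 30 * t = of_int m + of_int h * s"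
    "2 ^ 30 * z = of_int p + of_int q * s + of_int r * y"
    using assms(3) by auto
  obtain s' y' where sy': "\<bar>s'\<bar> \<le> 1" "\<bar>y'\<bar> \<le> 1" "2 ^ 30 * t' = of_int m + of_int h * s'"
    "2 ^ 30 * z' = of_int p + of_int q * s' + of_int r * y'"
    using assms(6) by auto
  define \<sigma> \<delta> where "\<sigma> = \<bar>s' - s\<bar>" and "\<delta> = \<bar>of_int r * (y' - y)\<bar>"
  note segment = in_strip_segment_derivative[OF assms(2) sy(1) sy'(1) sy(2) sy'(2) sy(3) sy'(3) sy(4) sy'(4)]
  have balance: "\<bar>A\<bar> = \<bar>B\<bar>" if "A + B = 0" for A B :: real
    using that by linarith
  obtain u v where uv: "in_strip ?S u v"
    "\<sigma> * \<bar>eval (along e) u v\<bar> = \<delta> * \<bar>eval (partial_z e) u v\<bar>"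
    using segment[OF assms(4,7)] balance unfolding along_def \<sigma>_def \<delta>_def abs_mult[symmetric] by blast
  obtain u' v' where uv': "in_strip ?S u' v'"
    "\<sigma> * \<bar>eval (along g) u' v'\<bar> = \<delta> * \<bar>eval (partial_z g) u' v'\<bar>"
    using segment[OF assms(5,8)] balance unfolding along_def \<sigma>_def \<delta>_def abs_mult[symmetric] by blast
  have nonneg: "0 \<le> \<sigma>" "0 \<le> \<delta>" by (simp_all add: \<sigma>_def \<delta>_def)
  have "\<delta> * b \<le> \<delta> * (2 ^ 48 * \<bar>eval (partial_z e) u v\<bar>)"
    using nonneg on_strip_bounds(2)[OF uv(1)] assms(2) by (intro mult_left_mono) (auto simp: b_def)
  also have "\<dots> = \<sigma> * (2 ^ 48 * \<bar>eval (along e) u v\<bar>)"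
    using uv(2) by (simp add: algebra_simps)
  also have "\<dots> \<le> \<sigma> * a"
    using nonneg on_strip_bounds(1)[OF uv(1)] assms(2) by (intro mult_left_mono) (auto simp: a_def)
  finally have 1: "\<delta> * b \<le> \<sigma> * a" .
  have "\<sigma> * c \<le> \<sigma> * (2 ^ 48 * \<bar>eval (along g) u' v'\<bar>)"
    using nonneg on_strip_bounds(2)[OF uv'(1)] assms(2) by (intro mult_left_mono) (auto simp: c_def)
  also have "\<dots> = \<delta> * (2 ^ 48 * \<bar>eval (partial_z g) u' v'\<bar>)"
    using uv'(2) by (simp add: algebra_simps)
  also have "\<dots> \<le> \<delta> * d"
    using nonneg on_strip_bounds(1)[OF uv'(1)] assms(2) by (intro mult_left_mono) (auto simp: d_def)
  finally have 2: "\<sigma> * c \<le> \<delta> * d" .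
  have "0 \<le> d"
    using on_strip_bounds(1)[OF uv'(1), of "partial_z g"] assms(2) unfolding d_def
    by (meson abs_ge_zero less_imp_le order_trans zero_le_mult_iff zero_le_numeral zero_le_power)
  \<comment> \<open>Chaining the two slope bounds gives \<sigma> b c \<le> \<sigma> a d, which
    \<open>a * d < b * c\<close> allows only for \<sigma> = 0.\<close>
  have "\<sigma> * (b * c) = (\<sigma> * c) * b" by simp
  also have "\<dots> \<le> (\<delta> * d) * b" using 2 \<open>0 < b\<close> by (intro mult_right_mono) auto
  also have "\<dots> = (\<delta> * b) * d" by simp
  also have "\<dots> \<le> (\<sigma> * a) * d" using 1 \<open>0 \<le> d\<close> by (intro mult_right_mono) auto
  finally have "\<sigma> * (b * c - a * d) \<le> 0" by (simp add: algebra_simps)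
  then have "\<sigma> = 0"
    using nonneg \<open>a * d < b * c\<close> by (simp add: mult_le_0_iff)
  moreover from this have "\<delta> = 0"
    using 1 nonneg \<open>0 < b\<close> by (simp add: mult_le_0_iff)
  ultimately have "s' = s" "y' = y" using assms(2) by (simp_all add: \<sigma>_def \<delta>_def)
  then show ?thesis using sy sy' by (metis mult_cancel_left power_not_zero zero_neq_numeral)
qed

section \<open>The eigenvalue equations as plane curves\<close>

datatype triangle = Triangle (w12: int) (w13: int) (w23: int) (v1: int) (v2: int) (v3: int)
  (m1: int) (m2: int) (m3: int)

definition solves :: "triangle \<Rightarrow> real \<Rightarrow> real \<Rightarrow> real \<Rightarrow> real \<Rightarrow> bool" where
  "solves W l x y z \<longleftrightarrow>
     of_int (w12 W) * (x + y) ^ 3 + of_int (w13 W) * (x + z) ^ 3 + of_int (v1 W) * x ^ 3 = l * of_int (m1 W) * x ^ 3 \<and>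
     of_int (w12 W) * (x + y) ^ 3 + of_int (w23 W) * (y + z) ^ 3 + of_int (v2 W) * y ^ 3 = l * of_int (m2 W) * y ^ 3 \<and>
     of_int (w13 W) * (x + z) ^ 3 + of_int (w23 W) * (y + z) ^ 3 + of_int (v3 W) * z ^ 3 = l * of_int (m3 W) * z ^ 3"

text \<open>On solutions, the sign of this expression compares the eigenvalue times the vertex
  weight with the integer c.\<close>

definition first_form :: "triangle \<Rightarrow> int \<Rightarrow> expr" where
  "first_form W c = Add (Add (Scale (w12 W) (Pow (Add T (Num 1)) 3)) (Scale (w13 W) (Pow (Add Z (Num 1)) 3)))
     (Num (v1 W - c))"

definition third_form :: "triangle \<Rightarrow> int \<Rightarrow> expr" where
  "third_form W c = Add (Add (Scale (w13 W) (Pow (Add Z (Num 1)) 3)) (Scale (w23 W) (Pow (Add T Z) 3)))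
     (Scale (v3 W - c) (Pow Z 3))"

text \<open>This is m2 t^3 times the first equation minus m1 times the second: the eigenvalue
  cancels without division, so t = 0 is allowed. The two potentials are merged exactly into one
  integer.\<close>

definition cross12 :: "triangle \<Rightarrow> expr" where
  "cross12 W = Add
     (Mul (Pow T 3)
       (Add (Add (Scale (m2 W * w12 W) (Pow (Add T (Num 1)) 3)) (Scale (m2 W * w13 W) (Pow (Add Z (Num 1)) 3)))
         (Num (m2 W * v1 W - m1 W * v2 W))))
     (Scale (- m1 W) (Add (Scale (w12 W) (Pow (Add T (Num 1)) 3)) (Scale (w23 W) (Pow (Add T Z) 3))))"

definition cross13 :: "triangle \<Rightarrow> expr" where
  "cross13 W = Add
     (Mul (Pow Z 3)
       (Add (Add (Scale (m3 W * w12 W) (Pow (Add T (Num 1)) 3)) (Scale (m3 W * w13 W) (Pow (Add Z (Num 1)) 3)))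
         (Num (m3 W * v1 W - m1 W * v3 W))))
     (Scale (- m1 W) (Add (Scale (w13 W) (Pow (Add Z (Num 1)) 3)) (Scale (w23 W) (Pow (Add T Z) 3))))"

lemma eval_first_form:
  "solves W l 1 t z \<Longrightarrow> eval (first_form W c) t z = l * of_int (m1 W) - of_int c"
  by (simp add: solves_def first_form_def add_ac)

lemma eval_third_form:
  "solves W l 1 t z \<Longrightarrow> eval (third_form W c) t z = (l * of_int (m3 W) - of_int c) * z ^ 3"
  by (simp add: solves_def third_form_def algebra_simps)

lemma cross_if_solves:
  assumes "solves W l 1 t z"
  shows "eval (cross12 W) t z = 0" and "eval (cross13 W) t z = 0"
proof -
  define P Q R :: real where "P = of_int (w12 W) * (1 + t) ^ 3" and "Q = of_int (w13 W) * (1 + z) ^ 3"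
    and "R = of_int (w23 W) * (t + z) ^ 3"
  have eqs: "P + Q + of_int (v1 W) = l * of_int (m1 W)" "P + R + of_int (v2 W) * t ^ 3 = l * of_int (m2 W) * t ^ 3"
    "Q + R + of_int (v3 W) * z ^ 3 = l * of_int (m3 W) * z ^ 3"
    using assms by (simp_all add: solves_def P_def Q_def R_def)
  have "eval (cross12 W) t z = of_int (m2 W) * t ^ 3 * (P + Q + of_int (v1 W)) - of_int (m1 W) * (P + R + of_int (v2 W) * t ^ 3)"
    by (simp add: cross12_def P_def Q_def R_def algebra_simps)
  then show "eval (cross12 W) t z = 0" unfolding eqs by simp
  have "eval (cross13 W) t z = of_int (m3 W) * z ^ 3 * (P + Q + of_int (v1 W)) - of_int (m1 W) * (Q + R + of_int (v3 W) * z ^ 3)"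
    by (simp add: cross13_def P_def Q_def R_def algebra_simps)
  then show "eval (cross13 W) t z = 0" unfolding eqs by simp
qed

lemma solves_if_cross:
  assumes "0 < m1 W" "eval (cross12 W) t z = 0" "eval (cross13 W) t z = 0"
  shows "\<exists>l. solves W l 1 t z"
proof -
  define P Q R :: real where "P = of_int (w12 W) * (1 + t) ^ 3" and "Q = of_int (w13 W) * (1 + z) ^ 3"
    and "R = of_int (w23 W) * (t + z) ^ 3"
  have "of_int (m1 W) * (P + R + of_int (v2 W) * t ^ 3) = of_int (m2 W) * t ^ 3 * (P + Q + of_int (v1 W))"
    using assms(2) by (simp add: cross12_def P_def Q_def R_def algebra_simps)
  moreover have "of_int (m1 W) * (Q + R + of_int (v3 W) * z ^ 3) = of_int (m3 W) * z ^ 3 * (P + Q + of_int (v1 W))"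
    using assms(3) by (simp add: cross13_def P_def Q_def R_def algebra_simps)
  ultimately have "solves W ((P + Q + of_int (v1 W)) / of_int (m1 W)) 1 t z"
    using assms(1) unfolding solves_def P_def[symmetric] Q_def[symmetric] R_def[symmetric]
    by (simp add: field_simps)
  then show ?thesis by blast
qed

text \<open>For t <= 0 the coefficient m2 w13 t^3 of (1 + z)^3 is nonpositive, and (t + z)^3 has the
  coefficient - m1 w23. No other term contains z.\<close>

lemma antimono_cross12:
  assumes "0 \<le> w13 W" "0 \<le> w23 W" "0 \<le> m1 W" "0 \<le> m2 W" "t \<le> 0"
  shows "antimono (eval (cross12 W) t)"
proof (rule antimonoI)
  fix y z :: real
  assume "y \<le> z"
  then have "(y + 1) ^ 3 \<le> (z + 1) ^ 3" "(t + y) ^ 3 \<le> (t + z) ^ 3"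
    by (auto intro!: power_mono_odd)
  moreover have "t ^ 3 * of_int (m2 W * w13 W) \<le> 0" "0 \<le> real_of_int (m1 W * w23 W)"
    using assms by (auto intro!: mult_nonpos_nonneg simp: power_le_zero_eq)
  ultimately have "(t ^ 3 * of_int (m2 W * w13 W)) * (z + 1) ^ 3 \<le> (t ^ 3 * of_int (m2 W * w13 W)) * (y + 1) ^ 3"
    "of_int (m1 W * w23 W) * (t + y) ^ 3 \<le> of_int (m1 W * w23 W) * (t + z) ^ 3"
    by (auto intro: mult_left_mono_neg mult_left_mono)
  then show "eval (cross12 W) t z \<le> eval (cross12 W) t y"
    by (simp add: cross12_def algebra_simps)
qed

text \<open>The first integer records how far the cover has reached, so neighbouring strips may
  overlap in t. What is covered is the half-open range from a up to, but without, b.\<close>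

fun covers :: "triangle \<Rightarrow> strip list \<Rightarrow> int \<Rightarrow> strip list \<Rightarrow> int \<Rightarrow> bool" where
  "covers W rs a [] b \<longleftrightarrow> b \<le> a"
| "covers W rs a ((m, h, p, q, r) # ss) b \<longleftrightarrow>
     m - h \<le> a \<and> brackets (cross12 W) (m, h, p, q, r) \<and>
     ((m, h, p, q, r) \<in> set rs \<or> excludes (cross13 W) (m, h, p, q, r)) \<and> covers W rs (m + h) ss b"

lemma in_root_strip_if_covers:
  assumes "covers W rs a ss b" "antimono (eval (cross12 W) t)"
    and "eval (cross12 W) t z = 0" "eval (cross13 W) t z = 0"
    and "of_int a \<le> 2 ^ 30 * t" "2 ^ 30 * t < of_int b"
  shows "\<exists>S\<in>set rs. in_strip S t z"
  using assms
proof (induction W rs a ss b rule: covers.induct)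
  case (1 W rs a b)
  then have "real_of_int b \<le> of_int a" by simp
  with 1 have False by linarith
  then show ?case ..
next
  case (2 W rs a m h p q r ss b)
  let ?S = "(m, h, p, q, r)"
  have "m - h \<le> a" and brackets: "brackets (cross12 W) ?S"
    and root: "?S \<in> set rs \<or> excludes (cross13 W) ?S" and rest: "covers W rs (m + h) ss b"
    using 2(2) unfolding covers.simps by blast+
  then have left: "of_int (m - h) \<le> 2 ^ 30 * t"
    using 2(6) by (meson of_int_le_iff order_trans)
  show ?case
  proof (cases "2 ^ 30 * t \<le> of_int (m + h)")
    case True
    then have "in_strip ?S t z"
      using in_strip_if_antimono[OF brackets 2(3,4) left] by blast
    moreover have "0 \<le> r"
      using brackets by simp
    ultimately show ?thesis
      using excludes_nonzero[of "cross13 W" m h p q r t z] root 2(5) by blast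
  next
    case False
    then show ?thesis
      using 2(1)[OF rest 2(3-5) _ 2(7)] by linarith
  qed
qed


text \<open>
  The given triangle with its vertices listed in the order \<open>(1, 2, 3)\<close>, \<open>(2, 1, 3)\<close> and \<open>(3, 1, 2)\<close>; thus vertex
  \<open>k\<close> carries the entry normalised to \<open>1\<close>.
\<close>

definition labelled :: "nat \<Rightarrow> triangle" where
  "labelled k =
     (if k = 1 then Triangle 8739145 3903820 8576922 (-3969860) (-8425563) 20915687727748 12411 482 20915691304489
      else if k = 2 then Triangle 8739145 8576922 3903820 (-8425563) (-3969860) 20915687727748 482 12411 20915691304489
      else Triangle 3903820 8576922 8739145 20915687727748 (-3969860) (-8425563) 20915691304489 12411 482)"

fun isolates :: "triangle \<Rightarrow> strip \<Rightarrow> bool" where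
  "isolates W S \<longleftrightarrow> brackets (cross12 W) S \<and> transversal (cross12 W) (cross13 W) S \<and>
     (crosses (cross13 W) S \<or> crosses (Scale (-1) (cross13 W)) S)"

definition positive_on :: "strip \<Rightarrow> expr \<Rightarrow> bool" where
  "positive_on S e \<longleftrightarrow> aff_pos (on_strip S e)"

text \<open>The bounds concern the eigenvalue times the weight of vertex 3, which stands first in
  the order for k = 3 and third otherwise. In third position the form carries a factor z^3;
  multiplying by z makes it z^4, so the sign of z does not matter.\<close>

fun isolates_between :: "nat \<times> strip \<times> int \<times> int \<Rightarrow> bool" where
  "isolates_between (k, S, a, b) \<longleftrightarrow> isolates (labelled k) S \<and>
     (if k = 3 then positive_on S (first_form (labelled k) a) \<and> positive_on S (Scale (-1) (first_form (labelled k) b))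
      else positive_on S (Mul Z (third_form (labelled k) a)) \<and> positive_on S (Scale (-1) (Mul Z (third_form (labelled k) b))))"

section \<open>Eigenlines\<close>

lemma proportionalI:
  "x \<in> nonzero_vecs n \<Longrightarrow> y \<in> nonzero_vecs n \<Longrightarrow> c \<noteq> 0 \<Longrightarrow> (\<And>i. y i = c * x i) \<Longrightarrow> (x, y) \<in> proportional n"
  unfolding proportional_def by blast

lemma proportionalE:
  assumes "(x, y) \<in> proportional n"
  obtains c where "x \<in> nonzero_vecs n" "y \<in> nonzero_vecs n" "c \<noteq> 0" "\<And>i. y i = c * x i"
  using assms unfolding proportional_def by auto

lemma proportional_equiv: "equiv (nonzero_vecs n) (proportional n)"
proof (rule equivI)
  show "proportional n \<subseteq> nonzero_vecs n \<times> nonzero_vecs n"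
    by (auto elim: proportionalE)
  show "refl_on (nonzero_vecs n) (proportional n)"
    by (rule refl_onI) (rule proportionalI[where c = 1]; simp)
  show "sym (proportional n)"
  proof (rule symI)
    fix x y assume "(x, y) \<in> proportional n"
    then obtain c where "x \<in> nonzero_vecs n" "y \<in> nonzero_vecs n" "c \<noteq> 0" "\<And>i. y i = c * x i"
      by (rule proportionalE) blast
    then show "(y, x) \<in> proportional n"
      by (intro proportionalI[where c = "inverse c"]) simp_all
  qed
  show "trans (proportional n)"
  proof (rule transI)
    fix x y z assume xy: "(x, y) \<in> proportional n" and yz: "(y, z) \<in> proportional n"
    obtain c where "x \<in> nonzero_vecs n" "c \<noteq> 0" "\<And>i. y i = c * x i"
      using xy by (rule proportionalE) blast
    moreover obtain c' where "z \<in> nonzero_vecs n" "c' \<noteq> 0" "\<And>i. z i = c' * y i"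
      using yz by (rule proportionalE) blast
    ultimately show "(x, z) \<in> proportional n"
      by (intro proportionalI[where c = "c' * c"]) simp_all
  qed
qed

lemma Phi_mult: "Phi p (c * t) = Phi p c * Phi p t"
  unfolding Phi_def abs_mult by (simp only: powr_mult abs_ge_zero mult_ac)

lemma Phi_eq_0_iff: "Phi p t = 0 \<longleftrightarrow> t = 0"
  by (auto simp: Phi_def)

lemma eigenpairD:
  assumes "eigenpair n p d l x"
  shows "x \<in> nonzero_vecs n"
    and "i \<in> {1..n} \<Longrightarrow> (\<Sum>j\<in>{1..n} - {i}. edge_weight d i j * Phi p (x i - signature d i j * x j))
      + potential d i * Phi p (x i) = l * vertex_weight d i * Phi p (x i)"
  using assms unfolding eigenpair_def by blast+

lemma eigenpair_scale:
  assumes "eigenpair n p d l x" "c \<noteq> 0"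
  shows "eigenpair n p d l (\<lambda>i. c * x i)"
  unfolding eigenpair_def
proof (intro conjI ballI)
  show "(\<lambda>i. c * x i) \<in> nonzero_vecs n"
    using assms(2) eigenpairD(1)[OF assms(1)] by (auto simp: nonzero_vecs_def)
next
  fix i assume i: "i \<in> {1..n}"
  have scale: "Phi p (c * x i - signature d i j * (c * x j)) = Phi p c * Phi p (x i - signature d i j * x j)" for j
    unfolding Phi_mult[symmetric] by (simp add: right_diff_distrib mult.left_commute)
  have "(\<Sum>j\<in>{1..n} - {i}. edge_weight d i j * Phi p (c * x i - signature d i j * (c * x j)))
        + potential d i * Phi p (c * x i)
      = Phi p c * ((\<Sum>j\<in>{1..n} - {i}. edge_weight d i j * Phi p (x i - signature d i j * x j))
        + potential d i * Phi p (x i))"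
    unfolding scale Phi_mult distrib_left sum_distrib_left by (simp only: mult.left_commute)
  also have "\<dots> = Phi p c * (l * vertex_weight d i * Phi p (x i))"
    unfolding eigenpairD(2)[OF assms(1) i] ..
  finally show "(\<Sum>j\<in>{1..n} - {i}. edge_weight d i j * Phi p (c * x i - signature d i j * (c * x j)))
        + potential d i * Phi p (c * x i) = l * vertex_weight d i * Phi p (c * x i)"
    unfolding Phi_mult by (simp only: mult_ac)
qed

lemma eigenvalue_unique:
  assumes "eigenpair n p d l x" "eigenpair n p d l' x" "is_graph_data n d"
  shows "l = l'"
proof -
  obtain i where i: "i \<in> {1..n}" "x i \<noteq> 0"
    using eigenpairD(1)[OF assms(1)] by (auto simp: nonzero_vecs_def)
  have "l * vertex_weight d i * Phi p (x i) = l' * vertex_weight d i * Phi p (x i)"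
    by (rule trans[OF sym[OF eigenpairD(2)[OF assms(1) i(1)]] eigenpairD(2)[OF assms(2) i(1)]])
  moreover have "0 < vertex_weight d i"
    using assms(3) i unfolding is_graph_data_def by blast
  ultimately show ?thesis
    using i by (simp add: Phi_eq_0_iff)
qed

text \<open>One representative is chosen in each family. Every eigenvector is a multiple of one of
  them, and their eigenvalues lie in separated intervals. Since a line determines its eigenvalue,
  this separates the lines as well.\<close>

lemma card_eigenlines_and_spectral_values:
  fixes K :: "nat \<Rightarrow> (nat \<Rightarrow> real) set"
  assumes data: "is_graph_data n d" "0 < n"
    and cover: "\<And>l x. eigenpair n p d l x \<Longrightarrow> \<exists>i<N. x \<in> K i"
    and line: "\<And>i l l' x x'. i < N \<Longrightarrow> eigenpair n p d l x \<Longrightarrow> x \<in> K i \<Longrightarrow>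
      eigenpair n p d l' x' \<Longrightarrow> x' \<in> K i \<Longrightarrow> \<exists>c. c \<noteq> 0 \<and> x' = (\<lambda>j. c * x j)"
    and ex: "\<And>i. i < N \<Longrightarrow> \<exists>l x. eigenpair n p d l x \<and> x \<in> K i \<and> lo i < l \<and> l < hi i"
    and sep: "\<And>i j. i < j \<Longrightarrow> j < N \<Longrightarrow> hi i \<le> lo j"
  shows "card (eigenlines n p d) = N" and "card (spectral_values n p d) = N"
    and "finite (spectral_values n p d)"
proof -
  obtain l x where lx: "\<And>i. i < N \<Longrightarrow> eigenpair n p d (l i) (x i) \<and> x i \<in> K i \<and> lo i < l i \<and> l i < hi i"
    using ex by metis
  have inj: "inj_on l {..<N}"
  proof (rule linorder_inj_onI)
    fix i j assume "i < j" "i \<in> {..<N}" "j \<in> {..<N}"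
    then have "l i < l j"
      using lx[of i] lx[of j] sep[of i j] by simp
    then show "l i \<noteq> l j" by simp
  qed auto
  have main: "\<exists>i<N. l' = l i \<and> proportional n `` {y} = proportional n `` {x i}"
    if y: "eigenpair n p d l' y" for l' y
  proof -
    obtain i where i: "i < N" "y \<in> K i" using cover[OF y] by blast
    then obtain c where c: "c \<noteq> 0" "y = (\<lambda>j. c * x i j)"
      using line[OF i(1)] lx[OF i(1)] y by blast
    then have "l' = l i"
      using eigenvalue_unique[OF y _ data(1)] eigenpair_scale lx[OF i(1)] by blast
    moreover have "(x i, y) \<in> proportional n"
      using c eigenpairD(1)[OF y] eigenpairD(1) lx[OF i(1)] by (intro proportionalI[of _ _ _ c]) (blast, simp_all)
    then have "proportional n `` {x i} = proportional n `` {y}"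
      by (rule equiv_class_eq[OF proportional_equiv])
    ultimately show ?thesis using i by auto
  qed
  have "spectral_values n p d = l ` {..<N}"
  proof (intro equalityI subsetI)
    fix l' assume "l' \<in> spectral_values n p d"
    then obtain y where "eigenpair n p d l' y" by (auto simp: spectral_values_def)
    then show "l' \<in> l ` {..<N}" using main by blast
  next
    fix l' assume "l' \<in> l ` {..<N}"
    then show "l' \<in> spectral_values n p d" using lx by (auto simp: spectral_values_def)
  qed
  then show "card (spectral_values n p d) = N" "finite (spectral_values n p d)"
    using inj by (simp_all add: card_image)
  have lines: "eigenlines n p d = (\<lambda>i. proportional n `` {x i}) ` {..<N}"
  proof (intro equalityI subsetI)
    fix L assume "L \<in> eigenlines n p d"
    then obtain l' y where "eigenpair n p d l' y" "L = proportional n `` {y}"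
      by (auto simp: eigenlines_def)
    then show "L \<in> (\<lambda>i. proportional n `` {x i}) ` {..<N}"
      using main by blast
  next
    fix L assume "L \<in> (\<lambda>i. proportional n `` {x i}) ` {..<N}"
    then obtain i where i: "i < N" "L = proportional n `` {x i}" by auto
    then have "L \<in> real_proj_space (n - 1)"
      using lx[OF i(1)] data(2) eigenpairD(1) by (fastforce simp: real_proj_space_def intro: quotientI)
    moreover have "eigenpair n p d (l i) (x i)" using lx i(1) by blast
    ultimately show "L \<in> eigenlines n p d"
      using i(2) unfolding eigenlines_def by blast
  qed
  have "inj_on (\<lambda>i. proportional n `` {x i}) {..<N}"
  proof (rule inj_onI)
    fix i j assume ij: "i \<in> {..<N}" "j \<in> {..<N}" "proportional n `` {x i} = proportional n `` {x j}"
    then have "(x i, x j) \<in> proportional n"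
      using eq_equiv_class[OF ij(3) proportional_equiv] lx[of j] eigenpairD(1) by auto
    then obtain c where "c \<noteq> 0" "x j = (\<lambda>k. c * x i k)"
      by (auto simp: proportional_def)
    moreover have "eigenpair n p d (l i) (x i)" "eigenpair n p d (l j) (x j)"
      using lx ij by auto
    ultimately have "l i = l j"
      using eigenpair_scale[of n p d "l i" "x i" c] eigenvalue_unique[OF _ _ data(1), of p "l i" "x j" "l j"]
      by simp
    then show "i = j" using inj ij by (auto dest: inj_onD)
  qed
  then show "card (eigenlines n p d) = N"
    unfolding lines by (simp add: card_image)
qed

text \<open>Perron-type uniqueness: at a vertex where the ratio of the two vectors is largest, comparing the
  equations gives the opposite inequality between the eigenvalues.\<close>

lemma positive_solution_unique:
  fixes x y :: "'a \<Rightarrow> real"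
  assumes I: "finite I" "I \<noteq> {}" and pos: "\<And>i. i \<in> I \<Longrightarrow> 0 < x i \<and> 0 < y i \<and> 0 < m i"
    and a: "\<And>i j. i \<in> I \<Longrightarrow> j \<in> I \<Longrightarrow> i \<noteq> j \<Longrightarrow> 0 < a i j"
    and x: "\<And>i. i \<in> I \<Longrightarrow> (\<Sum>j\<in>I - {i}. a i j * (x i + x j) ^ 3) + b i * x i ^ 3 = l * m i * x i ^ 3"
    and y: "\<And>i. i \<in> I \<Longrightarrow> (\<Sum>j\<in>I - {i}. a i j * (y i + y j) ^ 3) + b i * y i ^ 3 = l' * m i * y i ^ 3"
    and "l' \<le> l"
  shows "\<exists>c>0. \<forall>i\<in>I. x i = c * y i"
proof -
  define c where "c = Max ((\<lambda>i. x i / y i) ` I)"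
  have "c \<in> (\<lambda>i. x i / y i) ` I" unfolding c_def using I by (intro Max_in) auto
  then obtain i where i: "i \<in> I" "c = x i / y i" by auto
  have xi: "x i = c * y i" "0 < c" using i pos[of i] by simp_all
  have le: "x j \<le> c * y j" if "j \<in> I" for j
  proof -
    have "x j / y j \<le> c" unfolding c_def using I that by (intro Max_ge) auto
    then show ?thesis using pos[OF that] by (simp add: divide_le_eq)
  qed
  let ?f = "\<lambda>j. a i j * (x i + x j) ^ 3" and ?g = "\<lambda>j. a i j * (c * (y i + y j)) ^ 3"
  have mono: "?f j \<le> ?g j" if "j \<in> I - {i}" for j
    using that i(1) xi le[of j] a[of i j] pos[of i] pos[of j]
    by (intro mult_left_mono power_mono) (auto simp: algebra_simps)
  have "sum ?g (I - {i}) = c ^ 3 * (\<Sum>j\<in>I - {i}. a i j * (y i + y j) ^ 3)"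
    unfolding sum_distrib_left by (simp add: power_mult_distrib mult_ac)
  also have "\<dots> = c ^ 3 * (l' * m i * y i ^ 3 - b i * y i ^ 3)"
    using y[OF i(1)] by simp
  also have "\<dots> = l' * (m i * x i ^ 3) - b i * x i ^ 3"
    unfolding xi(1) by (simp add: power_mult_distrib algebra_simps)
  also have "\<dots> \<le> l * (m i * x i ^ 3) - b i * x i ^ 3"
    using \<open>l' \<le> l\<close> pos[OF i(1)] by (intro diff_right_mono mult_right_mono) auto
  also have "\<dots> = sum ?f (I - {i})"
    using x[OF i(1)] by simp
  finally have sum_le: "sum ?g (I - {i}) \<le> sum ?f (I - {i})" .
  \<comment> \<open>Termwise \<open>?f\<close> is at most \<open>?g\<close>, while the sums compare
    the other way, so no term can be strict. A positive edge weight can then be cancelled.\<close>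
  have "x j = c * y j" if "j \<in> I" for j
  proof (cases "j = i")
    case False
    with that have j: "j \<in> I - {i}" by simp
    have "?f j = ?g j"
    proof (rule ccontr)
      assume "?f j \<noteq> ?g j"
      then have "sum ?f (I - {i}) < sum ?g (I - {i})"
        using mono j I(1) by (intro sum_strict_mono_ex1) (auto simp: less_le)
      with sum_le show False by simp
    qed
    then have "(x i + x j) ^ 3 = (c * (y i + y j)) ^ 3"
      using a[of i j] i(1) j by auto
    then have "x i + x j = c * (y i + y j)"
      using pos[of i] pos[of j] i(1) j xi(2) by (subst (asm) power_eq_iff_eq_base) auto
    then show ?thesis using xi(1) by (simp add: algebra_simps)
  qed (use xi in simp)
  then show ?thesis using xi(2) by blast
qed

lemma solves_labelled:
  "solves (labelled 2) l y x z \<longleftrightarrow> solves (labelled 1) l x y z"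
  "solves (labelled 3) l z x y \<longleftrightarrow> solves (labelled 1) l x y z"
proof -
  have swap: "solves (Triangle a b c d e f g h i) l y x z \<longleftrightarrow> solves (Triangle a c b e d f h g i) l x y z"
    and rotate: "solves (Triangle a b c d e f g h i) l z x y \<longleftrightarrow> solves (Triangle c a b e f d h i g) l x y z"
    for a b c d e f g h i
    by (simp_all only: solves_def triangle.sel add.commute conj_ac)
  show "solves (labelled 2) l y x z \<longleftrightarrow> solves (labelled 1) l x y z"
    "solves (labelled 3) l z x y \<longleftrightarrow> solves (labelled 1) l x y z"
    by (simp_all add: labelled_def swap rotate)
qed


section \<open>The given triangle at p = 4\<close>

lemma Phi_4: "Phi 4 t = t ^ 3"
  by (simp add: Phi_def powr_numeral power3_eq_cube power2_eq_square)

lemma eigenpair_triangle_graph: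
  "eigenpair 3 4 triangle_graph l x \<longleftrightarrow> x \<in> nonzero_vecs 3 \<and> solves (labelled 1) l (x 1) (x 2) (x 3)"
proof -
  have I: "{1..3::nat} = {1, 2, 3}" by auto
  have D: "{1, 2, 3} - {1} = {2, 3::nat}" "{1, 2, 3} - {2} = {1, 3::nat}" "{1, 2, 3} - {3} = {1, 2::nat}"
    by auto
  have E: "edge_weight triangle_graph 1 2 = 8739145" "edge_weight triangle_graph 2 1 = 8739145"
    "edge_weight triangle_graph 1 3 = 3903820" "edge_weight triangle_graph 3 1 = 3903820"
    "edge_weight triangle_graph 2 3 = 8576922" "edge_weight triangle_graph 3 2 = 8576922"
    by (auto simp: triangle_graph_def doubleton_eq_iff)
  have V: "signature triangle_graph i j = - 1" "potential triangle_graph 1 = - 3969860"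
    "potential triangle_graph 2 = - 8425563" "potential triangle_graph 3 = 20915687727748"
    "vertex_weight triangle_graph 1 = 12411" "vertex_weight triangle_graph 2 = 482"
    "vertex_weight triangle_graph 3 = 20915691304489" for i j
    by (simp_all add: triangle_graph_def)
  have S: "(\<Sum>j\<in>{1, 2}. f j) = f 1 + f 2" "(\<Sum>j\<in>{1, 3}. f j) = f 1 + f 3" "(\<Sum>j\<in>{2, 3}. f j) = f 2 + f 3"
    for f :: "nat \<Rightarrow> real"
    by simp_all
  have L: "solves (labelled 1) l u v w \<longleftrightarrow>
      8739145 * (u + v) ^ 3 + 3903820 * (u + w) ^ 3 + - 3969860 * u ^ 3 = l * 12411 * u ^ 3 \<and>
      8739145 * (v + u) ^ 3 + 8576922 * (v + w) ^ 3 + - 8425563 * v ^ 3 = l * 482 * v ^ 3 \<and>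
      3903820 * (w + u) ^ 3 + 8576922 * (w + v) ^ 3 + 20915687727748 * w ^ 3 = l * 20915691304489 * w ^ 3"
    for u v w
    by (simp add: solves_def labelled_def add.commute)
  have sign: "u - - 1 * v = u + v" for u v :: real by simp
  show ?thesis
    unfolding eigenpair_def I ball_simps D Phi_4
    by (simp only: ball_simps HOL.simp_thms E V S L sign)
qed

section \<open>The covering by strips\<close>

text \<open>
  Vertex order, strip, and bounds for the eigenvalue times \<open>20915691304489\<close> (the weight of vertex 3) of the
  eight eigenvectors with entries of both signs.
\<close>

definition root_data :: "(nat \<times> strip \<times> int \<times> int) list" where
  "root_data =
   [(2, (-947945472, 1048576, -6947552, -15328, 256), -20000000000000, 1000000000000),
    (1, (-953778176, 786432, 4990752, -18592, 1536), 1000000000000, 1578000000000),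
    (1, (-1028751360, 786432, 6056288, -6192, 1280), 1578000000000, 10000000000000),
    (1, (-794132480, 786432, -7053168, -124928, 2048), 10000000000000, 20173000000000),
    (1, (-817758208, 786432, -3707168, -98640, 1792), 20173000000000, 20700000000000),
    (3, (-191332352, 16777216, -485581360, -28899152, 655360), 20700000000000, 20915691504489),
    (2, (-3244032, 1048576, -1397134672, -2420272, 3072), 20915691504489, 20915693304489),
    (1, (-287014912, 16777216, -516916144, -31048960, 917504), 20915693304489, 40000000000000)]"

text \<open>In all three lists the slope q / h follows the curve \<open>cross12\<close> = 0 near t =
  m, so r mainly absorbs its curvature. Strips get narrower near those of \<open>root_data\<close>,
  where excluding a zero of \<open>cross13\<close> takes a sharper enclosure.\<close>

definition strips_1 :: "strip list" where
  "strips_1 =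
   [(-1066057728, 7684096, 6302816, -45200, 114688),
    (-1052811264, 5562368, 6223008, -34720, 65536),
    (-1043038208, 4210688, 6159840, -28400, 40960),
    (-1036099584, 2727936, 6111568, -19728, 16384),
    (-1031823360, 1548288, 6079984, -11760, 5120),
    (-1029906432, 368640, 6065328, -2864, 320),
    (-1028751360, 786432, 6056288, -6192, 1280),
    (-1026736128, 1228800, 6040192, -9920, 3072),
    (-1023246336, 2260992, 6011264, -19104, 10240),
    (-1017389056, 3596288, 5959504, -32912, 28672),
    (-1009377280, 4415488, 5881632, -45296, 40960),
    (-999800832, 5160960, 5775776, -61024, 57344),
    (-989569024, 5070848, 5644896, -70016, 57344),
    (-979304448, 5193728, 5491312, -83872, 65536),
    (-969932800, 4177920, 5329280, -77728, 40960),
    (-962805760, 2949120, 5189968, -61024, 20480),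
    (-957939712, 1916928, 5085936, -42624, 10240),
    (-955293696, 729088, 5026192, -16848, 1280),
    (-953778176, 786432, 4990752, -18592, 1536),
    (-951803904, 1187840, 4943344, -28896, 3584),
    (-948125696, 2490368, 4850992, -63904, 14336),
    (-941563904, 4071424, 4673392, -114784, 40960),
    (-931667968, 5824512, 4372080, -188672, 81920),
    (-916930560, 8912896, 3837248, -352784, 196608),
    (-896671744, 11345920, 2911168, -583584, 393216),
    (-872415232, 12910592, 1449056, -891536, 458752),
    (-847421440, 12083200, -547328, -1107952, 458752),
    (-829841408, 5496832, -2291408, -608144, 98304),
    (-822001664, 2342912, -3187952, -281280, 16384),
    (-819101696, 557056, -3539728, -68912, 896),
    (-817758208, 786432, -3707168, -98640, 1792),
    (-815661056, 1310720, -3973408, -167968, 5120),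
    (-812146688, 2203648, -4432976, -292688, 14336),
    (-807051264, 2891776, -5128704, -404352, 24576),
    (-801718272, 2441216, -5893776, -359968, 20480),
    (-797696000, 1581056, -6497536, -242560, 8192),
    (-795516928, 598016, -6834624, -93728, 1280),
    (-794132480, 786432, -7053168, -124928, 2048),
    (-792338432, 1007616, -7340816, -162880, 3072),
    (-789585920, 1744896, -7792544, -289680, 10240),
    (-785432576, 2408448, -8497168, -416128, 20480),
    (-779706368, 3317760, -9516272, -605312, 40960),
    (-772276224, 4112384, -10923072, -804432, 57344),
    (-763076608, 5087232, -12805760, -1083136, 81920),
    (-751697920, 6291456, -15364912, -1484208, 131072),
    (-738410496, 6995968, -18696336, -1854496, 163840),
    (-722771968, 8642560, -23148784, -2617152, 262144),
    (-704520192, 9609216, -29127248, -3379152, 327680),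
    (-684228608, 10682368, -36885568, -4403968, 393216),
    (-661676032, 11870208, -47042464, -5786960, 524288),
    (-635142144, 14663680, -61342512, -8600176, 786432),
    (-604184576, 16293888, -81508800, -11642304, 1048576),
    (-569786368, 18104320, -108790208, -15730448, 1310720),
    (-531038208, 20643840, -146075568, -21676272, 1572864),
    (-484163584, 26230784, -200648720, -33153488, 2621440),
    (-424771584, 33161216, -283364800, -49794576, 4194304),
    (-352092160, 39518208, -401139072, -67941376, 6291456),
    (-308183040, 4390912, -477994624, -7972752, 65536),
    (-287014912, 16777216, -516916144, -31048960, 917504),
    (-252133376, 18104320, -582338720, -34361264, 1048576),
    (-204308480, 29720576, -674393040, -57769584, 2621440),
    (-132857856, 41730048, -814951040, -82781744, 5242880),
    (-45547520, 45580288, -989167568, -91317856, 5242880)]"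

definition strips_2 :: "strip list" where
  "strips_2 =
   [(-1064411136, 9330688, -6347424, 0, 5120),
    (-1047142400, 7938048, -6351440, -4416, 5120),
    (-1030873088, 8331264, -6368544, -13280, 7168),
    (-1014996992, 7544832, -6404848, -23200, 8192),
    (-1000792064, 6660096, -6460064, -31968, 7168),
    (-988430336, 5701632, -6529952, -37712, 6144),
    (-977461248, 5267456, -6612304, -44608, 5120),
    (-968171520, 4022272, -6698480, -41104, 3584),
    (-960905216, 3244032, -6777808, -37984, 2560),
    (-955375616, 2285568, -6845568, -29504, 1280),
    (-951607296, 1482752, -6895648, -20416, 512),
    (-949559296, 565248, -6924208, -8048, 80),
    (-947945472, 1048576, -6947552, -15328, 256),
    (-945643520, 1253376, -6981872, -19024, 384),
    (-941981696, 2408448, -7039360, -38720, 1536),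
    (-935878656, 3694592, -7142736, -65200, 3584),
    (-927096832, 5087232, -7308928, -101920, 7168),
    (-915718144, 6291456, -7556640, -146992, 12288),
    (-902430720, 6995968, -7895664, -193088, 16384),
    (-886792192, 8642560, -8371872, -285904, 28672),
    (-868540416, 9609216, -9041184, -386000, 40960),
    (-848248832, 10682368, -9946752, -523200, 49152),
    (-825696256, 11870208, -11176816, -712000, 81920),
    (-800628736, 13197312, -12855968, -974560, 98304),
    (-774234112, 13197312, -15020912, -1194064, 114688),
    (-746373120, 14663680, -17825264, -1622704, 163840),
    (-715415552, 16293888, -21658000, -2228944, 229376),
    (-682827776, 16293888, -26635472, -2760576, 327680),
    (-650240000, 16293888, -32782800, -3402464, 327680),
    (-615841792, 18104320, -40850032, -4713520, 524288),
    (-579633152, 18104320, -51493280, -5972320, 655360),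
    (-543424512, 18104320, -65055792, -7655040, 917504),
    (-507215872, 18104320, -82606960, -9999392, 1572864),
    (-471007232, 18104320, -105858896, -13424656, 2621440),
    (-436609024, 16293888, -135669312, -16513568, 3145728),
    (-404021248, 16293888, -174888256, -23074624, 5242880),
    (-373063680, 14663680, -227229968, -29537552, 6291456),
    (-343736320, 14663680, -298326960, -42137904, 10485760),
    (-314408960, 14663680, -398521392, -58218640, 14680064),
    (-281640960, 18104320, -544563840, -86476688, 20971520),
    (-230612992, 32923648, -772769744, -134783600, 41943040),
    (-134258688, 63430656, -1078551008, -169657424, 58720256),
    (-40894464, 29933568, -1310073296, -69359760, 3145728),
    (-7626752, 3334144, -1387018688, -7695728, 28672),
    (-3244032, 1048576, -1397134672, -2420272, 3072),
    (-1081344, 1114112, -1402126496, -2571536, 3072)]"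

definition strips_3 :: "strip list" where
  "strips_3 =
   [(-439033856, 97837056, -102612560, -127735104, 33554432),
    (-292691968, 48504832, -315635440, -79002720, 6291456),
    (-226148352, 18038784, -426001472, -30657872, 786432),
    (-191332352, 16777216, -485581360, -28899152, 655360),
    (-132825088, 41730048, -587265072, -72878848, 3670016),
    (-54198272, 36896768, -725247056, -65000816, 2621440),
    (-8634368, 8667136, -805570896, -15291984, 114688)]"

text \<open>It surrounds an approximate positive solution in the order (2, 1, 3), with t about 0.338
  and z about 0.0002. As t > 0, monotonicity is lost; here \<open>cross12\<close> is negative on the
  lower side and positive on the upper one, hence the factor -1 in its check.\<close>

definition positive_strip :: strip where
  "positive_strip = (362702080, 4096, 227784, -31380, 4096)"

definition root_strips :: "nat \<Rightarrow> strip list" where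
  "root_strips k = map (fst \<circ> snd) (filter (\<lambda>d. fst d = k) root_data)"

text \<open>The added interval is for the positive eigenvector; its upper end is only a generous
  bound.\<close>

definition root_intervals :: "(int \<times> int) list" where
  "root_intervals = map (snd \<circ> snd) root_data @ [(40000000000000, 10000000000000000000)]"

section \<open>Evaluation of the integer certificates\<close>

lemma isolates_between_root_data: "list_all isolates_between root_data"
  by code_simp

lemma covers_strips_1: "covers (labelled 1) (root_strips 1) (- (2 ^ 30)) strips_1 1"
  by code_simp

lemma covers_strips_2: "covers (labelled 2) (root_strips 2) (- (2 ^ 30)) strips_2 1"
  by code_simp

lemma covers_strips_3: "covers (labelled 3) (root_strips 3) (- (2 ^ 29)) strips_3 1"
  by code_simp

lemma positive_strip_checks:
  "brackets (Scale (-1) (cross12 (labelled 2))) positive_strip"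
  "crosses (Scale (-1) (cross13 (labelled 2))) positive_strip"
  "positive_on positive_strip T" "positive_on positive_strip Z"
  "positive_on positive_strip (Mul Z (third_form (labelled 2) 40000000000000))"
  "positive_on positive_strip (Scale (-1) (Mul Z (third_form (labelled 2) 10000000000000000000)))"
  by code_simp+

lemma root_data_charts: "list_all (\<lambda>d. fst d \<in> {1, 2, 3}) root_data"
  by code_simp

lemma root_intervals_sorted: "sorted_wrt (\<lambda>I J. snd I \<le> fst J) root_intervals"
  by code_simp

lemma length_root_data: "length root_data = 8"
  by (simp add: root_data_def)

section \<open>Classification of the eigenvectors\<close>

lemma in_root_strips_iff:
  "S \<in> set (root_strips k) \<longleftrightarrow> (\<exists>i<8. fst (root_data ! i) = k \<and> fst (snd (root_data ! i)) = S)"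
  by (auto simp: root_strips_def in_set_conv_nth length_root_data)

definition place :: "nat \<Rightarrow> real \<Rightarrow> real \<Rightarrow> nat \<Rightarrow> real" where
  "place k t z =
     (if k = 1 then (\<lambda>_. 0)(1 := 1, 2 := t, 3 := z)
      else if k = 2 then (\<lambda>_. 0)(1 := t, 2 := 1, 3 := z)
      else (\<lambda>_. 0)(1 := t, 2 := z, 3 := 1))"

lemma eigenpair_place:
  assumes "k \<in> {1, 2, 3}"
  shows "eigenpair 3 4 triangle_graph l (place k t z) \<longleftrightarrow> solves (labelled k) l 1 t z"
proof -
  have "\<exists>i\<in>{1..3}. place k t z i \<noteq> 0"
    using assms by (intro bexI[of _ k]) (auto simp: place_def)
  then have "place k t z \<in> nonzero_vecs 3"
    by (auto simp: nonzero_vecs_def place_def)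
  moreover have "solves (labelled 1) l (place k t z 1) (place k t z 2) (place k t z 3)
      \<longleftrightarrow> solves (labelled k) l 1 t z"
    using assms by (auto simp: place_def solves_labelled)
  ultimately show ?thesis
    by (simp add: eigenpair_triangle_graph)
qed

text \<open>The factor c makes each family invariant under scaling. In the last one it also admits
  vectors with all entries negative.\<close>

definition family :: "nat \<Rightarrow> (nat \<Rightarrow> real) set" where
  "family i =
     (if i < 8 then {\<lambda>j. c * place (fst (root_data ! i)) t z j | c t z.
        c \<noteq> 0 \<and> in_strip (fst (snd (root_data ! i))) t z}
      else {x. \<exists>c. c \<noteq> 0 \<and> (\<forall>j\<in>{1..3}. 0 < c * x j)})"

lemma familyI:
  assumes "i < 8" "c \<noteq> 0" "in_strip (fst (snd (root_data ! i))) t z"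
  shows "(\<lambda>j. c * place (fst (root_data ! i)) t z j) \<in> family i"
  using assms unfolding family_def by auto

lemma eval_pos_if_positive_on:
  assumes "positive_on S e" "in_strip S t z" "brackets f S"
  shows "0 < eval e t z"
proof (cases S)
  case (fields m h p q r)
  then show ?thesis
    using assms on_strip_pos[of m h p q r t z e] by (simp add: positive_on_def)
qed

lemma first_form_bound:
  assumes "solves W l 1 t z" "0 < eval (first_form W a) t z" "0 < eval (Scale (-1) (first_form W b)) t z"
  shows "of_int a < l * of_int (m1 W)" "l * of_int (m1 W) < of_int b"
  using assms(2,3) by (simp_all add: eval_first_form[OF assms(1)])

lemma third_form_bound:
  assumes "solves W l 1 t z" "0 < eval (Mul Z (third_form W a)) t z" "0 < eval (Scale (-1) (Mul Z (third_form W b))) t z"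
  shows "of_int a < l * of_int (m3 W)" "l * of_int (m3 W) < of_int b"
proof -
  have *: "eval (Mul Z (third_form W c)) t z = (l * of_int (m3 W) - of_int c) * z ^ 4" for c
    by (simp add: eval_third_form[OF assms(1)] power4_eq_xxxx power3_eq_cube)
  have neg: "eval (Scale (-1) e) t z = - eval e t z" for e by simp
  have "0 < (l * of_int (m3 W) - of_int a) * z ^ 4" "(l * of_int (m3 W) - of_int b) * z ^ 4 < 0"
    using assms(2,3) unfolding neg * by simp_all
  moreover have "0 \<le> z ^ 4" by simp
  ultimately show "of_int a < l * of_int (m3 W)" "l * of_int (m3 W) < of_int b"
    by (auto simp: zero_less_mult_iff mult_less_0_iff)
qed

lemma root_in_interval:
  assumes "i < 8" and data: "root_data ! i = (k, S, a, b)"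
  shows "\<exists>l t z. in_strip S t z \<and> solves (labelled k) l 1 t z
    \<and> of_int a < l * 20915691304489 \<and> l * 20915691304489 < of_int b"
proof -
  have check: "isolates_between (k, S, a, b)" and k: "k \<in> {1, 2, 3}"
    using isolates_between_root_data root_data_charts assms
    by (auto simp: list_all_length length_root_data dest!: spec[of _ i])
  obtain m h p q r where S: "S = (m, h, p, q, r)" by (cases S)
  have brackets: "brackets (cross12 (labelled k)) S"
    and "crosses (cross13 (labelled k)) S \<or> crosses (Scale (-1) (cross13 (labelled k))) S"
    using check unfolding isolates_between.simps isolates.simps by blast+
  then obtain t z where tz: "in_strip S t z" "eval (cross12 (labelled k)) t z = 0" "eval (cross13 (labelled k)) t z = 0"
    using zero_in_strip unfolding S by blast
  have "0 < m1 (labelled k)" by (simp add: labelled_def)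
  then obtain l where l: "solves (labelled k) l 1 t z"
    using solves_if_cross[OF _ tz(2,3)] by blast
  have "of_int a < l * 20915691304489 \<and> l * 20915691304489 < of_int b"
  proof (cases "k = 3")
    case True
    then have "positive_on S (first_form (labelled k) a)" "positive_on S (Scale (-1) (first_form (labelled k) b))"
      using check unfolding isolates_between.simps by auto
    then have "of_int a < l * of_int (m1 (labelled k)) \<and> l * of_int (m1 (labelled k)) < of_int b"
      using first_form_bound[OF l] eval_pos_if_positive_on[OF _ tz(1) brackets] by blast
    then show ?thesis
      using True by (simp add: labelled_def)
  next
    case False
    then have "positive_on S (Mul Z (third_form (labelled k) a))"
      "positive_on S (Scale (-1) (Mul Z (third_form (labelled k) b)))"
      using check unfolding isolates_between.simps by auto
    then have "of_int a < l * of_int (m3 (labelled k)) \<and> l * of_int (m3 (labelled k)) < of_int b"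
      using third_form_bound[OF l] eval_pos_if_positive_on[OF _ tz(1) brackets] by blast
    then show ?thesis
      using False k by (auto simp: labelled_def)
  qed
  with tz l show ?thesis by blast
qed

lemma positive_root:
  "\<exists>l t z. 0 < t \<and> 0 < z \<and> solves (labelled 2) l 1 t z
    \<and> 40000000000000 < l * 20915691304489 \<and> l * 20915691304489 < 10000000000000000000"
proof -
  obtain m h p q r where S: "positive_strip = (m, h, p, q, r)" by (cases positive_strip)
  obtain t z where tz: "in_strip positive_strip t z" "eval (cross12 (labelled 2)) t z = 0"
    "eval (cross13 (labelled 2)) t z = 0"
    using zero_in_strip[of "Scale (-1) (cross12 (labelled 2))" m h p q r "cross13 (labelled 2)"]
      positive_strip_checks(1,2) unfolding S by auto
  note pos = eval_pos_if_positive_on[OF _ tz(1) positive_strip_checks(1)]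
  obtain l where l: "solves (labelled 2) l 1 t z"
    using solves_if_cross[OF _ tz(2,3)] by (auto simp: labelled_def)
  have "0 < t" "0 < z"
    using pos[OF positive_strip_checks(3)] pos[OF positive_strip_checks(4)] by simp_all
  moreover have "of_int 40000000000000 < l * of_int (m3 (labelled 2))"
    "l * of_int (m3 (labelled 2)) < of_int 10000000000000000000"
    using third_form_bound[OF l pos[OF positive_strip_checks(5)] pos[OF positive_strip_checks(6)]] .
  ultimately show ?thesis
    using l by (auto simp: labelled_def)
qed

text \<open>Vertex 3 gives l <= 2, since both cubes in its equation are at most 1. For t <= -1/2 the
  estimates (1 + t)^3 <= -t^3 and (t + z)^3 <= t^3 bound the left side for vertex 1 by 865465 t^3,
  where 865465 = 8739145 - 3903820 - 3969860. As t^3 < 0, this is less than 2 * 12411 t^3, a lower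
  bound for the right side.\<close>

lemma left_of_half:
  assumes "solves (labelled 3) l 1 t z" "t < 0" "z < 0"
  shows "- (1 / 2) < t"
proof (rule ccontr)
  assume "\<not> - (1 / 2) < t"
  then have "1 + t \<le> - t" by simp
  then have "(1 + t) ^ 3 \<le> (- t) ^ 3" by (intro power_mono_odd) auto
  then have t: "(1 + t) ^ 3 \<le> - (t ^ 3)" by simp
  have tz: "(t + z) ^ 3 \<le> t ^ 3" using assms(3) by (intro power_mono_odd) auto
  have "(1 + t) ^ 3 \<le> 1 ^ 3" "(1 + z) ^ 3 \<le> 1 ^ 3"
    using assms by (intro power_mono_odd; simp)+
  moreover have "3903820 * (1 + t) ^ 3 + 8576922 * (1 + z) ^ 3 + 20915687727748 = l * 20915691304489"
    "3903820 * (1 + t) ^ 3 + 8739145 * (t + z) ^ 3 - 3969860 * t ^ 3 = l * 12411 * t ^ 3"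
    using assms(1) by (simp_all add: solves_def labelled_def)
  ultimately have "l \<le> 2" and eq: "3903820 * (1 + t) ^ 3 + 8739145 * (t + z) ^ 3 - 3969860 * t ^ 3 = l * 12411 * t ^ 3"
    by simp_all
  have "t ^ 3 < 0" using assms by simp
  then have "2 * 12411 * t ^ 3 \<le> l * 12411 * t ^ 3"
    using \<open>l \<le> 2\<close> by (simp add: mult_le_cancel_right)
  with eq t tz \<open>t ^ 3 < 0\<close> show False by linarith
qed

lemma family_if_solves:
  assumes k: "k \<in> {1, 2, 3}" and l: "solves (labelled k) l 1 t z"
    and t: "- 1 \<le> t" "t \<le> 0" "k = 3 \<Longrightarrow> - (1 / 2) \<le> t" and "c \<noteq> 0"
  shows "\<exists>i<9. (\<lambda>j. c * place k t z j) \<in> family i"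
proof -
  define ss where "ss = (if k = 1 then strips_1 else if k = 2 then strips_2 else strips_3)"
  have covers: "covers (labelled k) (root_strips k) (if k = 3 then - (2 ^ 29) else - (2 ^ 30)) ss 1"
    using k covers_strips_1 covers_strips_2 covers_strips_3 by (auto simp: ss_def)
  have antimono: "antimono (eval (cross12 (labelled k)) t)"
    using t(2) by (intro antimono_cross12) (simp_all add: labelled_def)
  \<comment> \<open>The cover ends at 1 instead of 0 so that the strict upper bound admits t =
    0.\<close>
  have "real_of_int (if k = 3 then - (2 ^ 29) else - (2 ^ 30)) \<le> 2 ^ 30 * t" "2 ^ 30 * t < of_int 1"
    using t by auto
  from in_root_strip_if_covers[OF covers antimono cross_if_solves[OF l] this]
  obtain S where "S \<in> set (root_strips k)" "in_strip S t z" by blast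
  then obtain i where "i < 8" "fst (root_data ! i) = k" "in_strip (fst (snd (root_data ! i))) t z"
    by (auto simp: in_root_strips_iff)
  then show ?thesis
    using familyI[OF _ \<open>c \<noteq> 0\<close>] by (intro exI[of _ i]) auto
qed

lemma solves_scale:
  assumes "c \<noteq> 0"
  shows "solves W l (c * x) (c * y) (c * z) \<longleftrightarrow> solves W l x y z"
proof -
  have scale: "A * (c * u + c * v) ^ 3 + B * (c * u' + c * v') ^ 3 + C * (c * w) ^ 3 = l * M * (c * w) ^ 3
      \<longleftrightarrow> A * (u + v) ^ 3 + B * (u' + v') ^ 3 + C * w ^ 3 = l * M * w ^ 3" for A B C M u v u' v' w :: real
  proof -
    have lhs: "A * (c * u + c * v) ^ 3 + B * (c * u' + c * v') ^ 3 + C * (c * w) ^ 3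
        = c ^ 3 * (A * (u + v) ^ 3 + B * (u' + v') ^ 3 + C * w ^ 3)"
      unfolding distrib_left[symmetric] power_mult_distrib by (simp add: algebra_simps)
    have rhs: "l * M * (c * w) ^ 3 = c ^ 3 * (l * M * w ^ 3)"
      by (simp add: power_mult_distrib)
    show ?thesis unfolding lhs rhs using assms by simp
  qed
  show ?thesis unfolding solves_def scale ..
qed

lemma eigenvector_in_family:
  assumes "eigenpair 3 4 triangle_graph l x"
  shows "\<exists>i<9. x \<in> family i"
proof -
  have x: "x \<in> nonzero_vecs 3" and l: "solves (labelled 1) l (x 1) (x 2) (x 3)"
    using assms by (auto simp: eigenpair_triangle_graph)
  have support: "x j = 0" if "j \<notin> {1, 2, 3}" for j
  proof -
    have "{1..3::nat} = {1, 2, 3}" by auto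
    then show ?thesis using x that by (auto simp: nonzero_vecs_def)
  qed
  have nonzero: "x 1 \<noteq> 0 \<or> x 2 \<noteq> 0 \<or> x 3 \<noteq> 0"
  proof -
    obtain j where "x j \<noteq> 0" using x by (auto simp: nonzero_vecs_def)
    then show ?thesis using support[of j] by auto
  qed
  have third: "3903820 * (x 1 + x 3) ^ 3 + 8576922 * (x 2 + x 3) ^ 3 + 20915687727748 * x 3 ^ 3
      = l * 20915691304489 * x 3 ^ 3"
    using l by (simp add: solves_def labelled_def)
  have places: "x 1 \<noteq> 0 \<Longrightarrow> x = (\<lambda>j. x 1 * place 1 (x 2 / x 1) (x 3 / x 1) j)"
    "x 2 \<noteq> 0 \<Longrightarrow> x = (\<lambda>j. x 2 * place 2 (x 1 / x 2) (x 3 / x 2) j)"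
    "x 3 \<noteq> 0 \<Longrightarrow> x = (\<lambda>j. x 3 * place 3 (x 1 / x 3) (x 2 / x 3) j)"
    using support by (auto simp: place_def fun_eq_iff)
  have charts: "x 1 \<noteq> 0 \<Longrightarrow> solves (labelled 1) l 1 (x 2 / x 1) (x 3 / x 1)"
    "x 2 \<noteq> 0 \<Longrightarrow> solves (labelled 2) l 1 (x 1 / x 2) (x 3 / x 2)"
    "x 3 \<noteq> 0 \<Longrightarrow> solves (labelled 3) l 1 (x 1 / x 3) (x 2 / x 3)"
    using l solves_scale[of "x 1" "labelled 1" l 1 "x 2 / x 1" "x 3 / x 1"]
      solves_scale[of "x 2" "labelled 2" l 1 "x 1 / x 2" "x 3 / x 2"]
      solves_scale[of "x 3" "labelled 3" l 1 "x 1 / x 3" "x 2 / x 3"]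
    by (simp_all add: solves_labelled)
  consider (opposite) "x 1 * x 2 \<le> 0" "\<bar>x 2\<bar> \<le> \<bar>x 1\<bar>" | (opposite') "x 1 * x 2 \<le> 0" "\<bar>x 1\<bar> < \<bar>x 2\<bar>"
    | (same) "0 < x 1 * x 2"
    by linarith
  then show ?thesis
  proof cases
    case opposite
    \<comment> \<open>If entries 1 and 2 both vanished, the first equation would make entry 3 vanish
      too.\<close>
    have "x 1 \<noteq> 0"
    proof
      assume "x 1 = 0"
      with opposite have "x 2 = 0" by simp
      with \<open>x 1 = 0\<close> l nonzero show False by (simp add: solves_def labelled_def)
    qed
    moreover have "- 1 \<le> x 2 / x 1" "x 2 / x 1 \<le> 0"
      using opposite \<open>x 1 \<noteq> 0\<close> by (cases "0 < x 1"; simp add: field_simps mult_le_0_iff)+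
    ultimately show ?thesis
      using family_if_solves[of 1 l "x 2 / x 1" "x 3 / x 1" "x 1"] charts(1) places(1) by simp
  next
    case opposite'
    then have "x 2 \<noteq> 0" by auto
    moreover have "- 1 \<le> x 1 / x 2" "x 1 / x 2 \<le> 0"
      using opposite' \<open>x 2 \<noteq> 0\<close> by (cases "0 < x 2"; simp add: field_simps mult_le_0_iff)+
    ultimately show ?thesis
      using family_if_solves[of 2 l "x 1 / x 2" "x 3 / x 2" "x 2"] charts(2) places(2) by simp
  next
    case same
    have "x 3 \<noteq> 0"
    proof
      assume "x 3 = 0"
      with third have "3903820 * x 1 ^ 3 + 8576922 * x 2 ^ 3 = 0" by simp
      moreover have "0 < x 1 ^ 3 \<and> 0 < x 2 ^ 3 \<or> x 1 ^ 3 < 0 \<and> x 2 ^ 3 < 0"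
        using same by (auto simp: zero_less_mult_iff)
      ultimately show False by linarith
    qed
    show ?thesis
    proof (cases "0 < x 1 * x 3")
      case True
      then have "\<forall>j\<in>{1..3}. 0 < x 1 * x j"
      proof -
        have "{1..3::nat} = {1, 2, 3}" by auto
        then show ?thesis using True same by (auto simp: zero_less_mult_iff)
      qed
      moreover have "x 1 \<noteq> 0" using same by auto
      ultimately have "x \<in> family 8" by (auto simp: family_def)
      then show ?thesis by (intro exI[of _ 8]) simp
    next
      case False
      \<comment> \<open>Entry 3 is opposite to both others. No comparison of sizes bounds x1 / x3
        here, so the range of t comes from \<open>left_of_half\<close>.\<close>
      then have "x 1 / x 3 < 0" "x 2 / x 3 < 0"
        using same \<open>x 3 \<noteq> 0\<close> by (auto simp: zero_less_mult_iff divide_less_0_iff not_less mult_le_0_iff)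
      moreover from this have "- (1 / 2) < x 1 / x 3"
        using left_of_half charts(3)[OF \<open>x 3 \<noteq> 0\<close>] by blast
      ultimately show ?thesis
        using family_if_solves[of 3 l "x 1 / x 3" "x 2 / x 3" "x 3"] charts(3) places(3) \<open>x 3 \<noteq> 0\<close> by simp
    qed
  qed
qed

text \<open>After normalisation both vectors solve the same two eliminated equations, which do not
  contain the eigenvalue. Uniqueness in the strip therefore applies although l and l' may differ a
  priori.\<close>

lemma transversal_in_family:
  assumes "i < 8" "eigenpair 3 4 triangle_graph l x" "x \<in> family i"
    "eigenpair 3 4 triangle_graph l' x'" "x' \<in> family i"
  shows "\<exists>c. c \<noteq> 0 \<and> x' = (\<lambda>j. c * x j)"
proof -
  obtain k S a b where data: "root_data ! i = (k, S, a, b)" by (cases "root_data ! i")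
  have check: "isolates_between (k, S, a, b)" and k: "k \<in> {1, 2, 3}"
    using isolates_between_root_data root_data_charts assms(1) data
    by (auto simp: list_all_length length_root_data dest!: spec[of _ i])
  obtain m h p q r where S: "S = (m, h, p, q, r)" by (cases S)
  have "brackets (cross12 (labelled k)) S" and transversal: "transversal (cross12 (labelled k)) (cross13 (labelled k)) S"
    using check unfolding isolates_between.simps isolates.simps by blast+
  then have "0 < r" by (simp add: S)
  obtain c t z where x: "c \<noteq> 0" "in_strip S t z" "x = (\<lambda>j. c * place k t z j)"
    using assms(1,3) data by (auto simp: family_def)
  obtain c' t' z' where x': "c' \<noteq> 0" "in_strip S t' z'" "x' = (\<lambda>j. c' * place k t' z' j)"
    using assms(1,5) data by (auto simp: family_def)
  have "eigenpair 3 4 triangle_graph l (place k t z)" "eigenpair 3 4 triangle_graph l' (place k t' z')"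
    using eigenpair_scale[OF assms(2), of "1 / c"] eigenpair_scale[OF assms(4), of "1 / c'"] x x' by simp_all
  then have "solves (labelled k) l 1 t z" "solves (labelled k) l' 1 t' z'"
    by (simp_all only: eigenpair_place[OF k])
  then have "t = t' \<and> z = z'"
    using transversal_unique[OF transversal[unfolded S] \<open>0 < r\<close>] x(2) x'(2) cross_if_solves unfolding S by blast
  then show ?thesis
    using x(1,3) x'(1,3) by (intro exI[of _ "c' / c"]) (auto simp: fun_eq_iff)
qed

lemma eigenpair_triangle_graph_cubes:
  assumes "eigenpair 3 4 triangle_graph l x" "i \<in> {1..3}"
  shows "(\<Sum>j\<in>{1..3} - {i}. edge_weight triangle_graph i j * (x i + x j) ^ 3) + potential triangle_graph i * x i ^ 3
    = l * vertex_weight triangle_graph i * x i ^ 3"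
proof -
  have "signature triangle_graph j j' = - 1" for j j'
    by (simp add: triangle_graph_def)
  then show ?thesis
    using assms by (simp add: eigenpair_def Phi_4)
qed

lemma is_graph_data_triangle_graph: "is_graph_data 3 triangle_graph"
  by (auto simp: is_graph_data_def triangle_graph_def insert_commute)

lemma positive_eigenvectors_proportional:
  assumes x: "eigenpair 3 4 triangle_graph l x" "\<forall>j\<in>{1..3}. 0 < x j"
    and y: "eigenpair 3 4 triangle_graph l' y" "\<forall>j\<in>{1..3}. 0 < y j" and "l' \<le> l"
  shows "\<exists>c>0. x = (\<lambda>j. c * y j)"
proof -
  have edges: "0 < edge_weight triangle_graph i j" if "i \<in> {1..3}" "j \<in> {1..3}" "i \<noteq> j" for i j
  proof -
    have "i = 1 \<or> i = 2 \<or> i = 3" "j = 1 \<or> j = 2 \<or> j = 3" using that by auto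
    then show ?thesis using that(3) by (auto simp: triangle_graph_def doubleton_eq_iff)
  qed
  have "\<exists>c>0. \<forall>j\<in>{1..3}. x j = c * y j"
    using x(2) y(2) is_graph_data_triangle_graph edges \<open>l' \<le> l\<close>
      eigenpair_triangle_graph_cubes[OF x(1)] eigenpair_triangle_graph_cubes[OF y(1)]
    by (intro positive_solution_unique[where m = "vertex_weight triangle_graph" and a = "edge_weight triangle_graph"
          and b = "potential triangle_graph" and l = l and l' = l'])
      (auto simp: is_graph_data_def)
  then obtain c where "0 < c" "\<forall>j\<in>{1..3}. x j = c * y j" by blast
  moreover have "x j = 0" "y j = 0" if "j \<notin> {1..3}" for j
    using x(1) y(1) that by (auto simp: eigenpair_def nonzero_vecs_def)
  ultimately have "x = (\<lambda>j. c * y j)"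
    by (metis (no_types, lifting) ext mult_zero_right)
  with \<open>0 < c\<close> show ?thesis by blast
qed

lemma proportional_in_family:
  assumes "i < 9" "eigenpair 3 4 triangle_graph l x" "x \<in> family i"
    "eigenpair 3 4 triangle_graph l' x'" "x' \<in> family i"
  shows "\<exists>c. c \<noteq> 0 \<and> x' = (\<lambda>j. c * x j)"
proof (cases "i < 8")
  case True
  then show ?thesis using transversal_in_family assms by blast
next
  case False
  obtain c where c: "c \<noteq> 0" "\<forall>j\<in>{1..3}. 0 < c * x j"
    using False assms(3) by (auto simp: family_def)
  obtain c' where c': "c' \<noteq> 0" "\<forall>j\<in>{1..3}. 0 < c' * x' j"
    using False assms(5) by (auto simp: family_def)
  have eig: "eigenpair 3 4 triangle_graph l (\<lambda>j. c * x j)" "eigenpair 3 4 triangle_graph l' (\<lambda>j. c' * x' j)"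
    using eigenpair_scale assms(2,4) c(1) c'(1) by blast+
  \<comment> \<open>The Perron comparison is one-sided in the eigenvalues, so the two vectors are
    ordered by them.\<close>
  consider "l' \<le> l" | "l \<le> l'" by linarith
  then show ?thesis
  proof cases
    case 1
    then obtain b where "0 < b" "(\<lambda>j. c * x j) = (\<lambda>j. b * (c' * x' j))"
      using positive_eigenvectors_proportional[OF eig(1) c(2) eig(2) c'(2)] by blast
    then show ?thesis
      using c(1) c'(1) by (intro exI[of _ "c / (b * c')"]) (auto simp: fun_eq_iff field_simps)
  next
    case 2
    then obtain b where "0 < b" "(\<lambda>j. c' * x' j) = (\<lambda>j. b * (c * x j))"
      using positive_eigenvectors_proportional[OF eig(2) c'(2) eig(1) c(2)] by blast
    then show ?thesis
      using c(1) c'(1) by (intro exI[of _ "b * c / c'"]) (auto simp: fun_eq_iff field_simps)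
  qed
qed

lemma eigenpair_in_family:
  assumes "i < 9"
  shows "\<exists>l x. eigenpair 3 4 triangle_graph l x \<and> x \<in> family i
    \<and> of_int (fst (root_intervals ! i)) < l * 20915691304489
    \<and> l * 20915691304489 < of_int (snd (root_intervals ! i))"
proof (cases "i < 8")
  case True
  obtain k S a b where data: "root_data ! i = (k, S, a, b)" by (cases "root_data ! i")
  have k: "k \<in> {1, 2, 3}"
    using root_data_charts True data by (auto simp: list_all_length length_root_data dest!: spec[of _ i])
  have ab: "root_intervals ! i = (a, b)"
    using True data by (simp add: root_intervals_def nth_append length_root_data)
  obtain l t z where ltz: "in_strip S t z" "solves (labelled k) l 1 t z"
    "of_int a < l * 20915691304489" "l * 20915691304489 < of_int b"
    using root_in_interval[OF True data] by blast
  have "place k t z \<in> family i"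
    using familyI[OF True, of 1 t z] ltz(1) data by simp
  moreover have "eigenpair 3 4 triangle_graph l (place k t z)"
    using ltz(2) eigenpair_place[OF k] by blast
  ultimately show ?thesis using ltz(3,4) ab by auto
next
  case False
  then have i: "i = 8" using assms by simp
  obtain l t z where ltz: "0 < t" "0 < z" "solves (labelled 2) l 1 t z"
    "40000000000000 < l * 20915691304489" "l * 20915691304489 < 10000000000000000000"
    using positive_root by blast
  have "place 2 t z \<in> family i"
    using ltz(1,2) by (auto simp: i family_def place_def intro!: exI[of _ 1])
  moreover have "eigenpair 3 4 triangle_graph l (place 2 t z)"
    using ltz(3) eigenpair_place[of 2] by blast
  moreover have "root_intervals ! i = (40000000000000, 10000000000000000000)"
    by (simp add: i root_intervals_def nth_append length_root_data)
  ultimately show ?thesis using ltz(4,5) by auto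
qed

theorem propositionE1:
  shows "is_graph_data 3 triangle_graph
    \<and> card (eigenlines 3 4 triangle_graph) = 9
    \<and> card (spectral_values 3 4 triangle_graph) = 9
    \<and> B_opt 3 \<ge> 9"
proof -
  let ?M = "20915691304489 :: real"
  define lo hi where "lo i = of_int (fst (root_intervals ! i)) / ?M"
    and "hi i = of_int (snd (root_intervals ! i)) / ?M" for i
  have sep: "hi i \<le> lo j" if "i < j" "j < 9" for i j
  proof -
    have "snd (root_intervals ! i) \<le> fst (root_intervals ! j)"
      using sorted_wrt_nth_less[OF root_intervals_sorted that(1)] that(2)
      by (simp add: root_intervals_def length_root_data)
    then show ?thesis by (simp add: lo_def hi_def divide_right_mono)
  qed
  have ex: "\<exists>l x. eigenpair 3 4 triangle_graph l x \<and> x \<in> family i \<and> lo i < l \<and> l < hi i" if "i < 9" for i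
    using eigenpair_in_family[OF that] by (simp add: lo_def hi_def field_simps)
  note counts = card_eigenlines_and_spectral_values[OF is_graph_data_triangle_graph _
      eigenvector_in_family proportional_in_family ex sep]
  have "card (spectral_values 3 4 triangle_graph) = 9" "finite (spectral_values 3 4 triangle_graph)"
    using counts(2,3) by simp_all
  then have "9 = ecard (spectral_values 3 4 triangle_graph)"
    by (simp add: ecard_def numeral_eq_enat)
  also have "\<dots> \<le> B_opt 3"
    unfolding B_opt_def using is_graph_data_triangle_graph
    by (intro SUP_upper2[of "(4, triangle_graph)"]) auto
  finally show ?thesis
    using is_graph_data_triangle_graph counts(1,2) by simp
qed

end
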